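(* Let $f:\mathbb{P}^k\to\mathbb{P}^k$ be a holomorphic endomorphism of algebraic degree $d\ge 2$ and let $\mu$ be its equilibrium measure. Let $\gamma,\epsilon>0$ satisfy the Constraints on $(\gamma,\epsilon)$ given in the context. Let $\hat x\in X$ be an orbit admitting linearization data $n_{\hat x}, h_{\hat x}, r_{\hat x},\rho_{\hat x},(\varphi_{\hat x,n})_{n\ge0},(D_{\hat x,n})_{n\ge0}$ as described in the context (such data exist for $\hat\mu$-almost every $\hat x\in X$). Let $r'_{\hat x}:=r_{\hat x}/h_{\hat x}$ and, for every $n\ge n_{\hat x}$ and $0<t\le1$, let $$E^{-n}_{\hat x}(t):=f^{-n}_{\hat x}\big(B_{x_0}(t r'_{\hat x})\big)\ \subset\ \widetilde E^{-n}_{\hat x}(t):=f^{-n}_{\hat x}\big(B_{x_0}(t r_{\hat x})\big).$$ Then for every pair of points $p,q\in E^{-n}_{\hat x}(t)$ there exists a smooth path connecting $p$ and $q$ in $\widetilde E^{-n}_{\hat x}(t)$ whose length is smaller than $e^{5n\epsilon}\,h_{\hat x}\,dist(p,q)$.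
   Context: The equilibrium measure $\mu$ of a holomorphic endomorphism $f$ of $\mathbb{P}^k$ of algebraic degree $d\ge2$ is its unique invariant probability measure of maximal entropy $\log d^k$; its Lyapunov exponents are positive and it does not charge the critical set $\mathcal C$ of $f$. Let $\Lambda_l<\cdots<\Lambda_1$ be the distinct Lyapunov exponents of $(f,\mu)$, with multiplicities $k_j\ge1$. Natural extension: $\mathsf O:=\{\hat x=(x_n)_{n\in\mathbb Z}: x_n\in\mathbb P^k,\ x_{n+1}=f(x_n)\}$; $\tau$ is the right shift $(\cdots,x_{-1},x_0,x_1,\cdots)\mapsto(\cdots,x_{-2},x_{-1},x_0,\cdots)$; $\hat\mu$ is the unique $\tau$-invariant measure on $\mathsf O$ with $\pi_*\hat\mu=\mu$, $\pi(\hat x)=x_0$. $X:=\{\hat x\in\mathsf O: x_n\notin\mathcal C\ \forall n\in\mathbb Z\}$, so $\hat\mu(X)=1$. For $\hat x\in X$, $f^{-n}_{\hat x}$ is the inverse branch of $f^n$ sending $x_0$ to $x_{-n}$. $dist$ is the distance on $\mathbb P^k$ induced by the Fubini–Study metric (lengths are with respect to this metric) and $B_x(r)$ is the ball centered at $x$ of radius $r$. $\mathbb D^k(r)$ is the polydisc of radius $r$ centered at $0$ in $\mathbb C^k$, and $|\cdot|$ is the maximum norm on $\mathbb C^k$, so $\mathbb D^k(r)=\{|v|<r\}$. $\mathbb C^k=L_1\oplus\cdots\oplus L_l$ with $L_j=\{0\}\times\cdots\times\mathbb C^{k_j}\times\cdots\times\{0\}$. Constraints on $(\gamma,\epsilon)$.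 Let $(\lambda_i)_{1\le i\le k}:=(\Lambda_1,\dots,\Lambda_1,\dots,\Lambda_l,\dots,\Lambda_l)$, each $\Lambda_j$ repeated $k_j$ times. Let $\mathfrak R_j:=\{\alpha\in\mathbb N^k: |\alpha|\ge2,\ \alpha_1\lambda_1+\cdots+\alpha_k\lambda_k=\Lambda_j\}$. Let $[\cdot]$ denote the integer part. Fix $0<a<\ln4$ such that $\alpha_1\lambda_1+\cdots+\alpha_k\lambda_k-\Lambda_j\notin[-a,a]$ for every $j\in\{1,\dots,l\}$ and every $\alpha\in\mathbb N^k\setminus\mathfrak R_j$ with $2\le|\alpha|\le[2\Lambda_1/\Lambda_l]$. Put $\Lambda_j^\gamma:=\Lambda_j-\gamma$ and $b:=\frac12\min\{\gamma,a\}$. The Constraints are: (1) $\gamma>0$, $\gamma<\Lambda_l/2$, $\gamma([\Lambda_1^\gamma/\Lambda_l^\gamma]-1)<a/2$, and $4\gamma(\Lambda_1^\gamma/\Lambda_l^\gamma+1)\le\Lambda_l^\gamma$; (2) $\epsilon>0$, $2\epsilon<\gamma$, $4\epsilon+2\gamma<\Lambda_l$, and $\epsilon([\Lambda_1^\gamma/\Lambda_l^\gamma]+3)<b$. Linearization data at $\hat x$: an integer $n_{\hat x}\ge1$, real numbers $h_{\hat x}\ge1$ and $0<r_{\hat x},\rho_{\hat x}\le1$; injective holomorphic maps $\varphi_{\hat x,n}:B_{x_{-n}}(r_{\hat x}e^{-n(\gamma+2\epsilon)})\to\mathbb D^k(\rho_{\hat x}e^{n\epsilon})$ ($n\ge0$)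 with $\varphi_{\hat x,n}(x_{-n})=0$ and $e^{n(\gamma-2\epsilon)}dist(u,v)\le|\varphi_{\hat x,n}(u)-\varphi_{\hat x,n}(v)|\le e^{n(\gamma+3\epsilon)}h_{\hat x}\,dist(u,v)$; linear maps $D_{\hat x,n}$ of $\mathbb C^k$ ($n\ge0$) stabilizing each $L_j$ with $e^{-n\Lambda_j+n(\gamma-\epsilon)}|v|\le|D_{\hat x,n}(v)|\le e^{-n\Lambda_j+n(\gamma+\epsilon)}|v|$ for $v\in L_j$; such that for every $n\ge n_{\hat x}$, $f^{-n}_{\hat x}$ is defined on $B_{x_0}(r_{\hat x})$ with image in $B_{x_{-n}}(r_{\hat x}e^{-n(\gamma+2\epsilon)})$, $D_{\hat x,n}$ maps $\mathbb D^k(\rho_{\hat x})$ into $\mathbb D^k(\rho_{\hat x}e^{n\epsilon})$, and $\varphi_{\hat x,n}\circ f^{-n}_{\hat x}=D_{\hat x,n}\circ\varphi_{\hat x,0}$ on $B_{x_0}(r_{\hat x})$.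
   Formalization: The length of the path is bounded by "at most" instead of "smaller than" e^{5nε} h dist(p,q), since for p = q the right-hand side is 0 and no path has length smaller than 0. *)

theory Defs
  imports "HOL-Probability.Probability"
begin

section \<open>Complex projective space\<close>

definition proportional :: "complex ^ 'n \<Rightarrow> complex ^ 'n \<Rightarrow> bool" where
  "proportional z w \<longleftrightarrow> z \<noteq> 0 \<and> w \<noteq> 0 \<and> (\<exists>c. c \<noteq> 0 \<and> z = c *s w)"

lemma proportional_refl: "z \<noteq> 0 \<Longrightarrow> proportional z z"
  unfolding proportional_def by (metis one_neq_zero vector_smult_lid)

lemma proportional_part_equivp: "part_equivp (proportional :: complex ^ 'n \<Rightarrow> _)"
proof (rule part_equivpI)
  have "(1 :: complex ^ 'n) \<noteq> 0" by simp
  then show "\<exists>z. proportional z (z :: complex ^ 'n)"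
    using proportional_refl by blast
  show "symp (proportional :: complex ^ 'n \<Rightarrow> _)"
  proof (rule sympI)
    fix z w :: "complex ^ 'n"
    assume "proportional z w"
    then obtain c where c: "z \<noteq> 0" "w \<noteq> 0" "c \<noteq> 0" "z = c *s w"
      unfolding proportional_def by blast
    then have "inverse c \<noteq> 0" "w = inverse c *s z"
      by (simp_all add: vector_smult_assoc)
    with c(1,2) show "proportional w z"
      unfolding proportional_def by blast
  qed
  show "transp (proportional :: complex ^ 'n \<Rightarrow> _)"
  proof (rule transpI)
    fix x y z :: "complex ^ 'n"
    assume "proportional x y" "proportional y z"
    then obtain c c' where c: "c \<noteq> 0" "c' \<noteq> 0" "x = c *s y" "y = c' *s z" "x \<noteq> 0" "z \<noteq> 0"
      unfolding proportional_def by blast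
    then have "c * c' \<noteq> 0" "x = (c * c') *s z"
      by (simp_all add: vector_smult_assoc)
    with c(5,6) show "proportional x z"
      unfolding proportional_def by blast
  qed
qed

text \<open>The points of \<open>\<P>\<^sup>k\<close>, with \<open>k = CARD('k)\<close>, are the complex lines in \<open>\<complex>\<^sup>k\<^sup>+\<^sup>1\<close>; the \<open>k + 1\<close>
  homogeneous coordinates are indexed by \<open>'k option\<close>.\<close>

quotient_type (overloaded) 'k cproj = "complex ^ ('k::finite option)" / partial: proportional
  morphisms rep_cproj proj
  by (rule proportional_part_equivp)

lemma proj_eq_iff:
  assumes "z \<noteq> 0" "w \<noteq> 0"
  shows "proj z = proj w \<longleftrightarrow> (\<exists>c. c \<noteq> 0 \<and> z = c *s w)"
proof -
  have "proportional z w \<longleftrightarrow> proj z = proj w"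
    using Quotient3_rel[OF Quotient3_cproj, of z w] proportional_refl[OF assms(1)]
      proportional_refl[OF assms(2)] by blast
  then show ?thesis
    using assms unfolding proportional_def by blast
qed

instantiation cproj :: (finite) topological_space
begin

definition open_cproj :: "'a cproj set \<Rightarrow> bool" where
  "open_cproj U \<longleftrightarrow> open {z. z \<noteq> 0 \<and> proj z \<in> U}"

instance
proof
  have "{z. z \<noteq> 0 \<and> proj z \<in> (UNIV :: 'a cproj set)} = - {0}" by auto
  moreover have "open (- {0 :: complex ^ ('a option)})" by (intro open_Compl closed_singleton)
  ultimately show "open (UNIV :: 'a cproj set)" unfolding open_cproj_def by (simp only:)
next
  fix S T :: "'a cproj set"
  assume "open S" "open T"
  then have "open ({z. z \<noteq> 0 \<and> proj z \<in> S} \<inter> {z. z \<noteq> 0 \<and> proj z \<in> T})"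
    unfolding open_cproj_def by (rule open_Int)
  moreover have "{z. z \<noteq> 0 \<and> proj z \<in> S} \<inter> {z. z \<noteq> 0 \<and> proj z \<in> T}
      = {z. z \<noteq> 0 \<and> proj z \<in> S \<inter> T}" by blast
  ultimately show "open (S \<inter> T)" unfolding open_cproj_def by (simp only:)
next
  fix K :: "'a cproj set set"
  assume "\<forall>S\<in>K. open S"
  then have "open (\<Union>S\<in>K. {z. z \<noteq> 0 \<and> proj z \<in> S})"
    unfolding open_cproj_def by (rule open_UN)
  moreover have "(\<Union>S\<in>K. {z. z \<noteq> 0 \<and> proj z \<in> S}) = {z. z \<noteq> 0 \<and> proj z \<in> \<Union>K}" by blast
  ultimately show "open (\<Union>K)" unfolding open_cproj_def by (simp only:)
qed

end

subsection \<open>Affine charts\<close>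

text \<open>\<open>coord_index i\<close> enumerates the homogeneous coordinates other than \<open>i\<close> by \<open>'k\<close>,
  and \<open>index_coord i\<close> is its inverse.\<close>

definition coord_index :: "'k option \<Rightarrow> 'k \<Rightarrow> 'k option" where
  "coord_index i j = (if i = Some j then None else Some j)"

definition index_coord :: "'k option \<Rightarrow> 'k option \<Rightarrow> 'k" where
  "index_coord i m = (case m of Some j \<Rightarrow> j | None \<Rightarrow> the i)"

lemma index_coord_coord_index: "index_coord i (coord_index i j) = j"
  by (auto simp: index_coord_def coord_index_def)

lemma coord_index_index_coord: "m \<noteq> i \<Longrightarrow> coord_index i (index_coord i m) = m"
  by (auto simp: index_coord_def coord_index_def split: option.splits)

lift_definition affine_part :: "'k::finite option \<Rightarrow> 'k cproj \<Rightarrow> bool" is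
  "\<lambda>i z. z $ i \<noteq> 0"
  by (auto simp: proportional_def)

definition affine_open :: "'k::finite option \<Rightarrow> 'k cproj set" where
  "affine_open i = {x. affine_part i x}"

lift_definition chart :: "'k::finite option \<Rightarrow> 'k cproj \<Rightarrow> complex ^ 'k" is
  "\<lambda>i z. \<chi> j. z $ coord_index i j / z $ i"
  by (auto simp: proportional_def vec_eq_iff)

definition chart_inv :: "'k::finite option \<Rightarrow> complex ^ 'k \<Rightarrow> 'k cproj" where
  "chart_inv i w = proj (\<chi> m. if m = i then 1 else w $ index_coord i m)"

lemma affine_open_proj: "z \<noteq> 0 \<Longrightarrow> proj z \<in> affine_open i \<longleftrightarrow> z $ i \<noteq> 0"
  by (simp add: affine_open_def affine_part.abs_eq proportional_refl)

lemma chart_proj: "z \<noteq> 0 \<Longrightarrow> chart i (proj z) = (\<chi> j. z $ coord_index i j / z $ i)"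
  by (simp add: chart.abs_eq proportional_refl)

lemma chart_inv_lift_nonzero: "(\<chi> m. if m = i then 1 else w $ index_coord i m) \<noteq> (0 :: complex ^ ('k::finite option))"
proof
  assume "(\<chi> m. if m = i then 1 else w $ index_coord i m) = (0 :: complex ^ ('k::finite option))"
  then have "(\<chi> m. if m = i then 1 else w $ index_coord i m) $ i = (0 :: complex ^ ('k::finite option)) $ i"
    by (rule arg_cong)
  then show False by simp
qed

lemma chart_inv_in_affine: "chart_inv i w \<in> affine_open i"
  unfolding chart_inv_def by (subst affine_open_proj[OF chart_inv_lift_nonzero]) simp

lemma chart_chart_inv: "chart i (chart_inv i w) = w"
proof -
  have "coord_index i j \<noteq> i" for j
    by (auto simp: coord_index_def)
  then show ?thesis
    unfolding chart_inv_def
    by (subst chart_proj[OF chart_inv_lift_nonzero]) (simp add: vec_eq_iff index_coord_coord_index)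
qed

text \<open>An affine chart around a given point; nothing below depends on which one is chosen.\<close>

definition chart_at :: "'k::finite cproj \<Rightarrow> 'k option" where
  "chart_at x = (SOME i. x \<in> affine_open i)"

subsection \<open>Holomorphic maps\<close>

definition holomorphic_vec_on :: "(complex ^ 'm \<Rightarrow> complex ^ 'n) \<Rightarrow> (complex ^ 'm) set \<Rightarrow> bool" where
  "holomorphic_vec_on g S \<longleftrightarrow>
     (\<forall>z\<in>S. \<exists>D. (g has_derivative D) (at z) \<and> (\<forall>c v. D (c *s v) = c *s D v))"

definition holomorphic_to_vec :: "('k::finite cproj \<Rightarrow> complex ^ 'n) \<Rightarrow> 'k cproj set \<Rightarrow> bool" where
  "holomorphic_to_vec \<phi> U \<longleftrightarrow>
     (\<forall>i. holomorphic_vec_on (\<phi> \<circ> chart_inv i) {w. chart_inv i w \<in> U})"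

definition holomorphic_to_cproj :: "('k::finite cproj \<Rightarrow> 'm::finite cproj) \<Rightarrow> 'k cproj set \<Rightarrow> bool" where
  "holomorphic_to_cproj g U \<longleftrightarrow> continuous_on U g \<and>
     (\<forall>i j. holomorphic_vec_on (chart j \<circ> g \<circ> chart_inv i)
              {w. chart_inv i w \<in> U \<and> g (chart_inv i w) \<in> affine_open j})"

definition homogeneous_poly :: "nat \<Rightarrow> (complex ^ 'n \<Rightarrow> complex) \<Rightarrow> bool" where
  "homogeneous_poly d P \<longleftrightarrow>
     (\<exists>c :: ('n \<Rightarrow> nat) \<Rightarrow> complex.
        \<forall>z. P z = (\<Sum>\<alpha> | (\<Sum>i\<in>UNIV. \<alpha> i) = d. c \<alpha> * (\<Prod>i\<in>UNIV. z $ i ^ \<alpha> i)))"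

definition algebraic_degree :: "('k::finite cproj \<Rightarrow> 'k cproj) \<Rightarrow> nat \<Rightarrow> bool" where
  "algebraic_degree f d \<longleftrightarrow>
     (\<exists>F :: complex ^ ('k option) \<Rightarrow> complex ^ ('k option).
        (\<forall>i. homogeneous_poly d (\<lambda>z. F z $ i)) \<and>
        (\<forall>z. z \<noteq> 0 \<longrightarrow> F z \<noteq> 0 \<and> f (proj z) = proj (F z)))"

definition holomorphic_endomorphism :: "('k::finite cproj \<Rightarrow> 'k cproj) \<Rightarrow> nat \<Rightarrow> bool" where
  "holomorphic_endomorphism f d \<longleftrightarrow> holomorphic_to_cproj f UNIV \<and> algebraic_degree f d"

text \<open>The differential of \<open>f\<close> at \<open>x\<close>, in the coordinates on the tangent spaces at \<open>x\<close> and \<open>f x\<close>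
  given by the charts \<open>chart_at x\<close> and \<open>chart_at (f x)\<close>.\<close>

definition tangent_map ::
    "('k::finite cproj \<Rightarrow> 'k cproj) \<Rightarrow> 'k cproj \<Rightarrow> complex ^ 'k \<Rightarrow> complex ^ 'k" where
  "tangent_map f x =
     frechet_derivative (chart (chart_at (f x)) \<circ> f \<circ> chart_inv (chart_at x))
       (at (chart (chart_at x) x))"

definition critical_set :: "('k::finite cproj \<Rightarrow> 'k cproj) \<Rightarrow> 'k cproj set" where
  "critical_set f = {x. \<not> bij (tangent_map f x)}"


section \<open>The Fubini--Study metric\<close>

text \<open>The Fubini--Study norm of the tangent vector with coordinates \<open>v\<close> at the point with
  coordinates \<open>w\<close>, in any affine chart:
  \<open>ds\<^sup>2 = ((1 + |w|\<^sup>2) |dw|\<^sup>2 - |\<langle>dw, w\<rangle>|\<^sup>2) / (1 + |w|\<^sup>2)\<^sup>2\<close>, the quotient of the round metric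
  of the unit sphere.\<close>

definition fs_norm :: "complex ^ 'k \<Rightarrow> complex ^ 'k \<Rightarrow> real" where
  "fs_norm w v =
     sqrt ((1 + (norm w)\<^sup>2) * (norm v)\<^sup>2 - (norm (\<Sum>j\<in>UNIV. v $ j * cnj (w $ j)))\<^sup>2)
       / (1 + (norm w)\<^sup>2)"

definition smooth_on :: "real set \<Rightarrow> (real \<Rightarrow> 'a::real_normed_vector) \<Rightarrow> bool" where
  "smooth_on S g \<longleftrightarrow>
     (\<exists>G :: nat \<Rightarrow> real \<Rightarrow> 'a. (\<forall>t\<in>S. G 0 t = g t) \<and>
        (\<forall>n. \<forall>t\<in>S. (G n has_vector_derivative G (Suc n) t) (at t within S)))"

definition smooth_curve_on :: "real set \<Rightarrow> (real \<Rightarrow> 'k::finite cproj) \<Rightarrow> bool" where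
  "smooth_curve_on S c \<longleftrightarrow> continuous_on S c \<and>
     (\<forall>i. smooth_on {t \<in> S. c t \<in> affine_open i} (chart i \<circ> c))"

definition piecewise_smooth_path :: "(real \<Rightarrow> 'k::finite cproj) \<Rightarrow> bool" where
  "piecewise_smooth_path c \<longleftrightarrow>
     (\<exists>(m::nat) s. s 0 = 0 \<and> s m = 1 \<and>
        (\<forall>j<m. s j < s (Suc j) \<and> smooth_curve_on {s j..s (Suc j)} c))"

definition fs_speed :: "(real \<Rightarrow> 'k::finite cproj) \<Rightarrow> real \<Rightarrow> real" where
  "fs_speed c t = (let i = chart_at (c t) in
     fs_norm (chart i (c t)) (vector_derivative (chart i \<circ> c) (at t within {0..1})))"

definition fs_length :: "(real \<Rightarrow> 'k::finite cproj) \<Rightarrow> real" where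
  "fs_length c = integral {0..1} (fs_speed c)"

definition fs_dist :: "'k::finite cproj \<Rightarrow> 'k cproj \<Rightarrow> real" where
  "fs_dist p q = Inf {fs_length c |c. piecewise_smooth_path c \<and> c 0 = p \<and> c 1 = q}"

definition fs_ball :: "'k::finite cproj \<Rightarrow> real \<Rightarrow> 'k cproj set" where
  "fs_ball x r = {y. fs_dist x y < r}"


section \<open>Equilibrium measure and Lyapunov exponents\<close>

definition invariant_prob :: "('k::finite cproj \<Rightarrow> 'k cproj) \<Rightarrow> 'k cproj measure \<Rightarrow> bool" where
  "invariant_prob f \<mu> \<longleftrightarrow> prob_space \<mu> \<and> sets \<mu> = sets borel \<and> distr \<mu> borel f = \<mu>"

text \<open>Finite partitions are given by labelling functions: the cells of \<open>X\<close> are its fibres, and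
  \<open>itinerary f X n\<close> labels the join of the preimages of the partition \<open>X\<close> under
  \<open>f\<^sup>0, \<dots>, f\<^sup>n\<^sup>-\<^sup>1\<close>.\<close>

definition partition_entropy :: "'a measure \<Rightarrow> ('a \<Rightarrow> 'b) \<Rightarrow> real" where
  "partition_entropy \<mu> X =
     - (\<Sum>y\<in>range X. measure \<mu> (X -` {y}) * ln (measure \<mu> (X -` {y})))"

definition itinerary :: "('a \<Rightarrow> 'a) \<Rightarrow> ('a \<Rightarrow> 'b) \<Rightarrow> nat \<Rightarrow> 'a \<Rightarrow> 'b list" where
  "itinerary f X n x = map (\<lambda>i. X ((f ^^ i) x)) [0..<n]"

definition measure_entropy :: "('a \<Rightarrow> 'a) \<Rightarrow> 'a measure \<Rightarrow> ereal" where
  "measure_entropy f \<mu> =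
     (SUP X \<in> {X :: 'a \<Rightarrow> nat. finite (range X) \<and> X \<in> measurable \<mu> (count_space UNIV)}.
        limsup (\<lambda>n. ereal (partition_entropy \<mu> (itinerary f X n) / real n)))"

definition equilibrium_measure ::
    "('k::finite cproj \<Rightarrow> 'k cproj) \<Rightarrow> nat \<Rightarrow> 'k cproj measure \<Rightarrow> bool" where
  "equilibrium_measure f d \<mu> \<longleftrightarrow>
     invariant_prob f \<mu> \<and> measure_entropy f \<mu> = ereal (ln (real (d ^ CARD('k)))) \<and>
     (\<forall>\<nu>. invariant_prob f \<nu> \<and> \<nu> \<noteq> \<mu> \<longrightarrow> measure_entropy f \<nu> < measure_entropy f \<mu>)"

definition growth_rate ::
    "('k::finite cproj \<Rightarrow> 'k cproj) \<Rightarrow> 'k cproj \<Rightarrow> complex ^ 'k \<Rightarrow> real \<Rightarrow> bool" where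
  "growth_rate f x v \<kappa> \<longleftrightarrow>
     (\<lambda>n. ln (fs_norm (chart (chart_at ((f ^^ n) x)) ((f ^^ n) x)) (tangent_map (f ^^ n) x v))
            / real n) \<longlonglongrightarrow> \<kappa>"

text \<open>\<open>\<Lambda> l < \<dots> < \<Lambda> 1\<close> are the distinct Lyapunov exponents of \<open>(f, \<mu>)\<close>, with multiplicities
  \<open>ks 1, \<dots>, ks l\<close>, in the sense of Oseledets' theorem for non-invertible maps:
  at almost every point, \<open>\<Lambda> j, \<dots>, \<Lambda> l\<close> are the growth rates of the nonzero vectors of the
  \<open>j\<close>-th subspace of the filtration, whose complex dimension is \<open>ks j + \<dots> + ks l\<close>.\<close>

definition lyapunov_spectrum ::
    "('k::finite cproj \<Rightarrow> 'k cproj) \<Rightarrow> 'k cproj measure \<Rightarrow> nat \<Rightarrow> (nat \<Rightarrow> real) \<Rightarrow> (nat \<Rightarrow> nat) \<Rightarrow> bool"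
  where
  "lyapunov_spectrum f \<mu> l \<Lambda> ks \<longleftrightarrow>
     1 \<le> l \<and> (\<forall>i j. 1 \<le> i \<and> i < j \<and> j \<le> l \<longrightarrow> \<Lambda> j < \<Lambda> i) \<and> (\<forall>j\<in>{1..l}. 1 \<le> ks j) \<and>
     (AE x in \<mu>.
        (\<forall>v. v \<noteq> 0 \<longrightarrow> (\<exists>j\<in>{1..l}. growth_rate f x v (\<Lambda> j))) \<and>
        (\<forall>j\<in>{1..l}. vec.subspace {v. v = 0 \<or> (\<exists>i\<in>{j..l}. growth_rate f x v (\<Lambda> i))} \<and>
           vec.dim {v. v = 0 \<or> (\<exists>i\<in>{j..l}. growth_rate f x v (\<Lambda> i))} = (\<Sum>i=j..l. ks i)))"

text \<open>The block \<open>j \<in> {1..l}\<close> to which the coordinate \<open>i\<close> of \<open>\<complex>\<^sup>k\<close> belongs: the first \<open>ks 1\<close>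
  coordinates form block \<open>1\<close>, the next \<open>ks 2\<close> ones block \<open>2\<close>, and so on.\<close>

definition block :: "(nat \<Rightarrow> nat) \<Rightarrow> 'k::{finite,linorder} \<Rightarrow> nat" where
  "block ks i = (LEAST j. card {i'. i' < i} < (\<Sum>m=1..j. ks m))"

definition block_space :: "(nat \<Rightarrow> nat) \<Rightarrow> nat \<Rightarrow> (complex ^ 'k::{finite,linorder}) set" where
  "block_space ks j = {v. \<forall>i. block ks i \<noteq> j \<longrightarrow> v $ i = 0}"


section \<open>The constraints on the parameters\<close>

definition weight ::
    "(nat \<Rightarrow> real) \<Rightarrow> (nat \<Rightarrow> nat) \<Rightarrow> ('k::{finite,linorder} \<Rightarrow> nat) \<Rightarrow> real" where
  "weight \<Lambda> ks \<alpha> = (\<Sum>i\<in>UNIV. real (\<alpha> i) * \<Lambda> (block ks i))"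

definition resonances ::
    "(nat \<Rightarrow> real) \<Rightarrow> (nat \<Rightarrow> nat) \<Rightarrow> nat \<Rightarrow> ('k::{finite,linorder} \<Rightarrow> nat) set" where
  "resonances \<Lambda> ks j = {\<alpha>. 2 \<le> (\<Sum>i\<in>UNIV. \<alpha> i) \<and> weight \<Lambda> ks \<alpha> = \<Lambda> j}"

definition resonance_gap ::
    "'k::{finite,linorder} itself \<Rightarrow> nat \<Rightarrow> (nat \<Rightarrow> real) \<Rightarrow> (nat \<Rightarrow> nat) \<Rightarrow> real \<Rightarrow> bool" where
  "resonance_gap _ l \<Lambda> ks a \<longleftrightarrow> 0 < a \<and> a < ln 4 \<and>
     (\<forall>j\<in>{1..l}. \<forall>\<alpha> :: 'k \<Rightarrow> nat.
        \<alpha> \<notin> resonances \<Lambda> ks j \<and> 2 \<le> (\<Sum>i\<in>UNIV. \<alpha> i) \<and>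
        int (\<Sum>i\<in>UNIV. \<alpha> i) \<le> \<lfloor>2 * \<Lambda> 1 / \<Lambda> l\<rfloor> \<longrightarrow>
        weight \<Lambda> ks \<alpha> - \<Lambda> j \<notin> {-a..a})"

definition constraints :: "nat \<Rightarrow> (nat \<Rightarrow> real) \<Rightarrow> real \<Rightarrow> real \<Rightarrow> real \<Rightarrow> bool" where
  "constraints l \<Lambda> a \<gamma> \<epsilon> \<longleftrightarrow>
     (let R = (\<Lambda> 1 - \<gamma>) / (\<Lambda> l - \<gamma>); b = min \<gamma> a / 2 in
        \<gamma> > 0 \<and> \<gamma> < \<Lambda> l / 2 \<and> \<gamma> * (of_int \<lfloor>R\<rfloor> - 1) < a / 2 \<and> 4 * \<gamma> * (R + 1) \<le> \<Lambda> l - \<gamma> \<and>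
        \<epsilon> > 0 \<and> 2 * \<epsilon> < \<gamma> \<and> 4 * \<epsilon> + 2 * \<gamma> < \<Lambda> l \<and> \<epsilon> * (of_int \<lfloor>R\<rfloor> + 3) < b)"


section \<open>Orbits, inverse branches and linearization data\<close>

definition orbits :: "('k::finite cproj \<Rightarrow> 'k cproj) \<Rightarrow> (int \<Rightarrow> 'k cproj) set" where
  "orbits f = {x. \<forall>n. x (n + 1) = f (x n)}"

definition noncritical_orbits :: "('k::finite cproj \<Rightarrow> 'k cproj) \<Rightarrow> (int \<Rightarrow> 'k cproj) set" where
  "noncritical_orbits f = {x \<in> orbits f. \<forall>n. x n \<notin> critical_set f}"

definition inverse_branch_on ::
    "('k::finite cproj \<Rightarrow> 'k cproj) \<Rightarrow> (int \<Rightarrow> 'k cproj) \<Rightarrow> nat \<Rightarrow> 'k cproj set \<Rightarrow>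
     ('k cproj \<Rightarrow> 'k cproj) \<Rightarrow> bool" where
  "inverse_branch_on f x n U g \<longleftrightarrow>
     holomorphic_to_cproj g U \<and> (\<forall>y\<in>U. (f ^^ n) (g y) = y) \<and> g (x 0) = x (- int n)"

definition max_norm :: "complex ^ 'k \<Rightarrow> real" where
  "max_norm v = Max (range (\<lambda>i. norm (v $ i)))"

definition polydisc :: "real \<Rightarrow> (complex ^ 'k) set" where
  "polydisc r = {v. max_norm v < r}"

text \<open>\<open>finv n\<close> is the inverse branch of \<open>f\<^sup>n\<close> along the orbit \<open>x\<close>; it is only constrained on the
  ball of radius \<open>r\<close> around \<open>x 0\<close> and for \<open>n \<ge> n0\<close>, and is uniquely determined there.\<close>

definition linearization_data ::
    "('k::{finite,linorder} cproj \<Rightarrow> 'k cproj) \<Rightarrow> nat \<Rightarrow> (nat \<Rightarrow> real) \<Rightarrow> (nat \<Rightarrow> nat) \<Rightarrow>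
     real \<Rightarrow> real \<Rightarrow> (int \<Rightarrow> 'k cproj) \<Rightarrow> nat \<Rightarrow> real \<Rightarrow> real \<Rightarrow> real \<Rightarrow>
     (nat \<Rightarrow> 'k cproj \<Rightarrow> (complex, 'k) vec) \<Rightarrow> (nat \<Rightarrow> (complex, 'k) vec \<Rightarrow> (complex, 'k) vec) \<Rightarrow>
     (nat \<Rightarrow> 'k cproj \<Rightarrow> 'k cproj) \<Rightarrow> bool" where
  "linearization_data f l \<Lambda> ks \<gamma> \<epsilon> x n0 h r \<rho> \<phi> D finv \<longleftrightarrow>
     1 \<le> n0 \<and> 1 \<le> h \<and> 0 < r \<and> r \<le> 1 \<and> 0 < \<rho> \<and> \<rho> \<le> 1 \<and>
     (\<forall>n. let B = fs_ball (x (- int n)) (r * exp (- real n * (\<gamma> + 2 * \<epsilon>))) in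
        inj_on (\<phi> n) B \<and> holomorphic_to_vec (\<phi> n) B \<and>
        \<phi> n ` B \<subseteq> polydisc (\<rho> * exp (real n * \<epsilon>)) \<and> \<phi> n (x (- int n)) = 0 \<and>
        (\<forall>u\<in>B. \<forall>v\<in>B.
           exp (real n * (\<gamma> - 2 * \<epsilon>)) * fs_dist u v \<le> max_norm (\<phi> n u - \<phi> n v) \<and>
           max_norm (\<phi> n u - \<phi> n v) \<le> exp (real n * (\<gamma> + 3 * \<epsilon>)) * h * fs_dist u v)) \<and>
     (\<forall>n. Vector_Spaces.linear (*s) (*s) (D n) \<and>
        (\<forall>j\<in>{1..l}. D n ` block_space ks j \<subseteq> block_space ks j \<and>
           (\<forall>v\<in>block_space ks j.
              exp (- real n * \<Lambda> j + real n * (\<gamma> - \<epsilon>)) * max_norm v \<le> max_norm (D n v) \<and>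
              max_norm (D n v) \<le> exp (- real n * \<Lambda> j + real n * (\<gamma> + \<epsilon>)) * max_norm v))) \<and>
     (\<forall>n\<ge>n0.
        inverse_branch_on f x n (fs_ball (x 0) r) (finv n) \<and>
        finv n ` fs_ball (x 0) r \<subseteq> fs_ball (x (- int n)) (r * exp (- real n * (\<gamma> + 2 * \<epsilon>))) \<and>
        D n ` polydisc \<rho> \<subseteq> polydisc (\<rho> * exp (real n * \<epsilon>)) \<and>
        (\<forall>y\<in>fs_ball (x 0) r. \<phi> n (finv n y) = D n (\<phi> 0 y)))"

end

theory Submission
  imports Defs "HOL-Complex_Analysis.Cauchy_Integral_Formula"
begin

text \<open>The path is the preimage under \<open>\<phi> n\<close> of the straight segment from \<open>\<phi> n p\<close> to \<open>\<phi> n q\<close>.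
  This segment is the image under the linear map \<open>D n\<close> of a segment in the polydisc of radius
  \<open>t * r\<close>, and that polydisc lies in the image under \<open>\<phi> 0\<close> of the ball of radius \<open>t * r\<close>; hence
  the path stays in \<open>Etilde n t\<close>. Its length is controlled by the lower Lipschitz bound of \<open>\<phi> n\<close>,
  and \<open>\<phi> n p - \<phi> n q\<close> by the upper one; the quotient of the two constants is the claimed factor.

  The distance \<open>fs_dist\<close> is compared with the infinitesimal metric through the map sending a line
  to the orthogonal projection onto it: this is an embedding of \<open>\<P>\<^sup>k\<close> into a space of matrices
  which multiplies lengths of curves by \<open>\<surd>2\<close>, so that \<open>\<surd>2 * fs_dist\<close> dominates the
  Euclidean distance of matrices, while \<open>\<surd>2 * fs_speed\<close> is exactly the speed of the matrix curve.\<close>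

section \<open>Homogeneous and affine coordinates\<close>

lemma cproj_cases:
  obtains z where "z \<noteq> 0" "x = proj z"
proof -
  have "proportional (rep_cproj x) (rep_cproj x)"
    using Quotient3_rep_reflp[OF Quotient3_cproj] .
  then have "rep_cproj x \<noteq> 0" by (simp add: proportional_def)
  moreover have "x = proj (rep_cproj x)"
    using Quotient3_abs_rep[OF Quotient3_cproj] by metis
  ultimately show ?thesis using that by blast
qed

lemma affine_open_cover: "\<exists>i. x \<in> affine_open i"
proof -
  obtain z where z: "z \<noteq> 0" "x = proj z" by (rule cproj_cases)
  then obtain i where "z $ i \<noteq> 0" by (auto simp: vec_eq_iff)
  with z show ?thesis by (auto simp: affine_open_proj)
qed

lemma in_affine_open_chart_at: "x \<in> affine_open (chart_at x)"
  unfolding chart_at_def using affine_open_cover by (rule someI_ex)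

text \<open>Lift of affine data to homogeneous coordinates: \<open>s = 1\<close> lifts a point of
  the chart, and \<open>s = 0\<close> lifts a tangent vector, since the normalized coordinate
  \<open>i\<close> is constant along a curve in the chart.\<close>

definition homog :: "'k::finite option \<Rightarrow> complex \<Rightarrow> complex ^ 'k \<Rightarrow> complex ^ 'k option" where
  "homog i s w = (\<chi> m. if m = i then s else w $ index_coord i m)"

lemma homog_nth [simp]: "homog i s w $ m = (if m = i then s else w $ index_coord i m)"
  by (simp add: homog_def)

lemma homog_1_nonzero [simp]: "homog i 1 w \<noteq> 0"
  by (auto simp: vec_eq_iff intro!: exI[of _ i])

lemma chart_inv_homog: "chart_inv i w = proj (homog i 1 w)"
  by (simp add: chart_inv_def homog_def)

lemma chart_inv_chart:
  assumes "x \<in> affine_open i" shows "chart_inv i (chart i x) = x"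
proof -
  obtain z where z: "z \<noteq> 0" "x = proj z" by (rule cproj_cases)
  with assms have zi: "z $ i \<noteq> 0" by (simp add: affine_open_proj)
  have "homog i 1 (chart i x) = (1 / z $ i) *s z"
    using zi by (auto simp: vec_eq_iff z(2) chart_proj[OF z(1)] coord_index_index_coord)
  then show ?thesis unfolding chart_inv_homog z
    by (subst proj_eq_iff) (use z zi in \<open>auto intro!: exI[of _ "1 / z $ i"]\<close>)
qed

lemma inj_chart_inv: "inj (chart_inv i)"
  by (metis injI chart_chart_inv)

lemma sum_homog_coords:
  fixes F :: "'k::finite option \<Rightarrow> 'a::comm_monoid_add"
  shows "sum F UNIV = F i + (\<Sum>j\<in>UNIV. F (coord_index i j))"
proof -
  have "bij_betw (coord_index i) UNIV (UNIV - {i})"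
    by (rule bij_betw_byWitness[where f'="index_coord i"])
      (auto simp: index_coord_coord_index coord_index_index_coord, auto simp: coord_index_def split: if_splits)
  then have "(\<Sum>j\<in>UNIV. F (coord_index i j)) = sum F (UNIV - {i})"
    by (rule sum.reindex_bij_betw)
  then show ?thesis by (simp add: sum.remove[of UNIV i F])
qed

lemma coord_index_neq [simp]: "coord_index i j \<noteq> i"
  by (auto simp: coord_index_def)

section \<open>Topology of the affine charts\<close>

lemma continuous_on_proj: "continuous_on (- {0}) proj"
proof -
  have "open {z. z \<noteq> 0 \<and> proj z \<in> B}" if "open B" for B :: "'a cproj set"
    using that by (simp add: open_cproj_def)
  moreover have "proj -` B \<inter> - {0} = {z. z \<noteq> 0 \<and> proj z \<in> B}" for B :: "'a cproj set" by auto
  ultimately show ?thesis by (subst continuous_on_open_vimage) (auto simp: open_Compl)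
qed

lemma continuous_homog: "continuous_on UNIV (homog i s)"
proof -
  have "continuous_on UNIV (\<lambda>w. if m = i then s else w $ index_coord i m)" for m
    by (cases "m = i") (auto intro!: continuous_intros)
  then show ?thesis unfolding homog_def by (intro continuous_on_vec_lambda)
qed

lemma continuous_chart_inv: "continuous_on UNIV (chart_inv i)"
proof -
  have "continuous_on UNIV (proj \<circ> homog i 1)"
    by (intro continuous_on_compose continuous_homog continuous_on_subset[OF continuous_on_proj]) auto
  then show ?thesis by (simp add: comp_def chart_inv_homog[abs_def])
qed

lemma open_affine_open: "open (affine_open i)"
proof -
  have "{z. z \<noteq> 0 \<and> proj z \<in> affine_open i} = {z. z $ i \<noteq> 0}"
    by (intro Collect_cong) (metis affine_open_proj zero_index)
  moreover have "open {z::complex^'a option. z $ i \<noteq> 0}"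
    by (intro open_Collect_neq continuous_intros)
  ultimately show ?thesis unfolding open_cproj_def by simp
qed

section \<open>Hermitian products\<close>

definition herm :: "complex ^ 'n \<Rightarrow> complex ^ 'n \<Rightarrow> complex" where
  "herm u z = (\<Sum>a\<in>UNIV. u $ a * cnj (z $ a))"

lemma norm_power2_vec: "(norm (z :: complex ^ 'n))\<^sup>2 = (\<Sum>a\<in>UNIV. (norm (z $ a))\<^sup>2)"
  by (simp add: norm_vec_def L2_set_def sum_nonneg)

lemma Re_herm: "Re (herm u z) = z \<bullet> u"
  by (simp add: herm_def inner_vec_def inner_complex_def Re_sum mult_ac)

text \<open>Gram-Schmidt for the Hermitian product: \<open>\<alpha> *s z\<close> is the projection
  of \<open>u\<close> to the line of \<open>z\<close>, and the second claim is Pythagoras multiplied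
  by |z|^2. It yields Cauchy-Schwarz, and it identifies the Fubini-Study radicand with |z|^2 |e|^2
  for the component e of \<open>u\<close> orthogonal to the line.\<close>

lemma norm_perp_component:
  fixes u z :: "complex ^ 'n"
  assumes "z \<noteq> 0"
  defines "\<alpha> \<equiv> herm u z / of_real ((norm z)\<^sup>2)"
  shows "herm (u - \<alpha> *s z) z = 0"
    and "(norm z)\<^sup>2 * (norm (u - \<alpha> *s z))\<^sup>2 = (norm z)\<^sup>2 * (norm u)\<^sup>2 - (norm (herm u z))\<^sup>2"
proof -
  let ?N = "(norm z)\<^sup>2"
  have N: "?N > 0" using assms by simp
  have hz: "herm z z = of_real ?N"
    by (simp only: herm_def norm_power2_vec of_real_sum complex_norm_square)
  have "herm (u - \<alpha> *s z) z = herm u z - \<alpha> * herm z z"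
    by (simp add: herm_def sum_subtractf sum_distrib_left algebra_simps)
  also have "\<dots> = 0" using N by (simp add: hz \<alpha>_def)
  finally show "herm (u - \<alpha> *s z) z = 0" .
  have "(norm (u $ a - \<alpha> * z $ a))\<^sup>2
      = (norm (u $ a))\<^sup>2 + (norm \<alpha>)\<^sup>2 * (norm (z $ a))\<^sup>2 - 2 * Re (cnj \<alpha> * (u $ a * cnj (z $ a)))" for a
    by (simp only: cmod_power2) (simp add: power2_eq_square algebra_simps)
  then have "(norm (u - \<alpha> *s z))\<^sup>2
      = (norm u)\<^sup>2 + (norm \<alpha>)\<^sup>2 * ?N - 2 * Re (cnj \<alpha> * herm u z)"
    unfolding norm_power2_vec[of "u - \<alpha> *s z"]
    by (simp add: sum.distrib sum_subtractf norm_power2_vec herm_def sum_distrib_left Re_sum)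
  moreover have "Re (cnj \<alpha> * herm u z) = ?N * (norm \<alpha>)\<^sup>2"
  proof -
    have "herm u z = of_real ?N * \<alpha>" using N by (simp add: \<alpha>_def)
    then have "cnj \<alpha> * herm u z = of_real (?N * (norm \<alpha>)\<^sup>2)"
      by (simp only: of_real_mult complex_norm_square) (simp add: mult_ac)
    then show ?thesis by simp
  qed
  moreover have "?N * (?N * (norm \<alpha>)\<^sup>2) = (norm (herm u z))\<^sup>2"
  proof -
    have "norm \<alpha> = norm (herm u z) / ?N" by (simp add: \<alpha>_def norm_divide norm_power)
    then show ?thesis using assms(1) by (simp only: power_divide) (simp add: power2_eq_square)
  qed
  \<comment> \<open>The preceding facts combine by pure real algebra, isolated here for arbitrary
    reals.\<close>
  moreover have "X = U + A * N - 2 * R \<Longrightarrow> R = N * A \<Longrightarrow> N * (N * A) = H \<Longrightarrow> N * X = N * U - H"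
    for X U A N R H :: real
  proof -
    assume h: "X = U + A * N - 2 * R" "R = N * A" "N * (N * A) = H"
    then have "X = U - N * A" by (simp add: mult.commute)
    then show "N * X = N * U - H" using h(3) by (simp add: right_diff_distrib)
  qed
  ultimately show "?N * (norm (u - \<alpha> *s z))\<^sup>2 = ?N * (norm u)\<^sup>2 - (norm (herm u z))\<^sup>2"
    by blast
qed

lemma norm_herm_le: "norm (herm u z) \<le> norm u * norm z"
proof (cases "z = 0")
  case False
  have "0 \<le> (norm z)\<^sup>2 * (norm u)\<^sup>2 - (norm (herm u z))\<^sup>2"
    using norm_perp_component(2)[OF False, of u] by (metis mult_nonneg_nonneg zero_le_power2)
  then have "(norm (herm u z))\<^sup>2 \<le> (norm u * norm z)\<^sup>2" by (simp add: power_mult_distrib mult.commute)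
  then show ?thesis by (rule power2_le_imp_le) simp
qed (simp add: herm_def)

lemma fs_norm_herm:
  "fs_norm w v = sqrt ((1 + (norm w)\<^sup>2) * (norm v)\<^sup>2 - (norm (herm v w))\<^sup>2) / (1 + (norm w)\<^sup>2)"
  by (simp add: fs_norm_def herm_def)

text \<open>Cauchy-Schwarz leaves the summand |v|^2 over; this makes the square root meaningful and
  the metric positive definite.\<close>

lemma fs_norm_radicand_ge: "(norm v)\<^sup>2 \<le> (1 + (norm w)\<^sup>2) * (norm v)\<^sup>2 - (norm (herm v w))\<^sup>2"
  using power_mono[OF norm_herm_le[of v w], of 2] by (simp add: algebra_simps power_mult_distrib)

lemma fs_norm_nonneg: "0 \<le> fs_norm w v"
  unfolding fs_norm_herm
  by (intro divide_nonneg_nonneg real_sqrt_ge_zero order_trans[OF zero_le_power2 fs_norm_radicand_ge]) simp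

lemma fs_norm_pos:
  assumes "v \<noteq> 0" shows "0 < fs_norm w v"
proof -
  have "0 < (norm v)\<^sup>2" using assms by simp
  then have "0 < (1 + (norm w)\<^sup>2) * (norm v)\<^sup>2 - (norm (herm v w))\<^sup>2"
    using fs_norm_radicand_ge[of v w] by linarith
  then show ?thesis
    unfolding fs_norm_herm by (intro divide_pos_pos real_sqrt_gt_zero) (auto simp: add_pos_nonneg)
qed

text \<open>The factor 1 + |w|^2 in the radicand is dominated by the square of the denominator.
  Hence Euclidean segments in a chart bound \<open>fs_dist\<close> from above.\<close>

lemma fs_norm_le_norm: "fs_norm w v \<le> norm v"
proof -
  let ?N = "1 + (norm w)\<^sup>2"
  have N: "1 \<le> ?N" by simp
  have "?N * (norm v)\<^sup>2 - (norm (herm v w))\<^sup>2 \<le> ?N\<^sup>2 * (norm v)\<^sup>2"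
    using mult_right_mono[OF N, of "?N * (norm v)\<^sup>2"] by (simp add: power2_eq_square mult_ac)
       (smt (verit) zero_le_square)
  then have "sqrt (?N * (norm v)\<^sup>2 - (norm (herm v w))\<^sup>2) \<le> ?N * norm v"
    using N by (intro real_le_lsqrt) (auto simp: power_mult_distrib)
  moreover have "0 < ?N" using N by linarith
  ultimately show ?thesis unfolding fs_norm_herm
    by (simp only: pos_divide_le_eq mult.commute)
qed

section \<open>The embedding by orthogonal projections\<close>

text \<open>The matrix z z^* / |z|^2 of the orthogonal projection to the line of \<open>z\<close>;
  the real normalization makes it invariant under complex rescaling of \<open>z\<close>.\<close>

definition line_projection :: "complex ^ 'n \<Rightarrow> complex ^ 'n ^ 'n" where
  "line_projection z = (\<chi> a b. (z $ a * cnj (z $ b)) /\<^sub>R (z \<bullet> z))"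

text \<open>Product and quotient rule for z z^* / |z|^2 in direction \<open>u\<close>, with 2
  \<open>z \<bullet> u\<close> as the derivative of |z|^2.\<close>

definition line_projection_deriv :: "complex ^ 'n \<Rightarrow> complex ^ 'n \<Rightarrow> complex ^ 'n ^ 'n" where
  "line_projection_deriv z u = (\<chi> a b. (u $ a * cnj (z $ b) + z $ a * cnj (u $ b)) /\<^sub>R (z \<bullet> z)
     - (2 * (z \<bullet> u) / (z \<bullet> z)\<^sup>2) *\<^sub>R (z $ a * cnj (z $ b)))"

lemma inner_scalar_mult_self: "(c *s z) \<bullet> (c *s z) = (norm c)\<^sup>2 * (z \<bullet> (z :: complex ^ 'n))"
  by (simp add: inner_vec_def sum_distrib_left power2_norm_eq_inner[symmetric] norm_mult power_mult_distrib)

text \<open>This is the Segre map applied to the pair ([z], [cnj z]) and normalized to trace one;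
  hence the name. Being a global map into a normed space, it replaces computations in varying charts
  by the derivative of a single vector-valued curve.\<close>

lift_definition segre :: "'k::finite cproj \<Rightarrow> complex ^ 'k option ^ 'k option" is line_projection
proof -
  fix z w :: "complex ^ 'k option"
  assume "proportional z w"
  then obtain c where c: "c \<noteq> 0" "z = c *s w" by (auto simp: proportional_def)
  have "(c * x * cnj (c * y)) /\<^sub>R ((norm c)\<^sup>2 * N) = (x * cnj y) /\<^sub>R N" for x y N
  proof -
    have "c * x * cnj (c * y) = (norm c)\<^sup>2 *\<^sub>R (x * cnj y)"
      by (simp only: scaleR_conv_of_real complex_norm_square) (simp add: mult_ac)
    then show ?thesis using c(1) by simp
  qed
  then show "line_projection z = line_projection w"
    unfolding line_projection_def c(2) inner_scalar_mult_self by (simp add: vec_eq_iff)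
qed

lemma segre_proj: "z \<noteq> 0 \<Longrightarrow> segre (proj z) = line_projection z"
  by (simp add: segre.abs_eq proportional_refl)

section \<open>Differential of the projection embedding\<close>

lemma has_vector_derivative_vec_lambda:
  assumes "\<And>i. ((\<lambda>t. f t i) has_vector_derivative f' i) (at x within S)"
  shows "((\<lambda>t. \<chi> i. f t i) has_vector_derivative (\<chi> i. f' i)) (at x within S)"
  using assms unfolding has_vector_derivative_def has_derivative_within
  by (auto intro!: vec_tendstoI bounded_linear_scaleR_left)

lemma has_vector_derivative_vec_nth:
  "(z has_vector_derivative u) F \<Longrightarrow> ((\<lambda>t. z t $ a) has_vector_derivative u $ a) F"
  by (rule bounded_linear.has_vector_derivative[OF bounded_linear_vec_nth])

lemma has_vector_derivative_line_projection:
  fixes z :: "real \<Rightarrow> complex ^ 'n"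
  assumes z: "(z has_vector_derivative u) (at t within S)" and "z t \<noteq> 0"
  shows "((\<lambda>t. line_projection (z t)) has_vector_derivative line_projection_deriv (z t) u) (at t within S)"
  unfolding line_projection_def line_projection_deriv_def
proof (intro has_vector_derivative_vec_lambda)
  fix a b
  have N: "z t \<bullet> z t \<noteq> 0" using assms by simp
  have zd: "(z has_derivative (\<lambda>h. h *\<^sub>R u)) (at t within S)"
    using z by (simp add: has_vector_derivative_def)
  from has_derivative_inner[OF zd zd] have "((\<lambda>t. z t \<bullet> z t) has_field_derivative 2 * (z t \<bullet> u)) (at t within S)"
    unfolding has_field_derivative_def
    by (rule has_derivative_eq_rhs) (auto simp: inner_commute)
  from DERIV_inverse_fun[OF this N]
  have inv: "((\<lambda>t. inverse (z t \<bullet> z t)) has_field_derivative - (2 * (z t \<bullet> u) / (z t \<bullet> z t)\<^sup>2)) (at t within S)"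
    by (rule DERIV_cong) (simp add: field_simps power2_eq_square)
  have b: "((\<lambda>t. cnj (z t $ b)) has_vector_derivative cnj (u $ b)) (at t within S)"
    by (rule bounded_linear.has_vector_derivative[OF bounded_linear_cnj has_vector_derivative_vec_nth[OF z]])
  show "((\<lambda>t. (z t $ a * cnj (z t $ b)) /\<^sub>R (z t \<bullet> z t)) has_vector_derivative
      (u $ a * cnj (z t $ b) + z t $ a * cnj (u $ b)) /\<^sub>R (z t \<bullet> z t) -
      (2 * (z t \<bullet> u) / (z t \<bullet> z t)\<^sup>2) *\<^sub>R (z t $ a * cnj (z t $ b))) (at t within S)"
    using has_vector_derivative_scaleR[OF inv has_vector_derivative_mult[OF has_vector_derivative_vec_nth[OF z, of a] b]]
    by (simp add: add.commute)
qed

lemma norm_line_projection_deriv: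
  fixes z u :: "complex ^ 'n"
  assumes "z \<noteq> 0"
  shows "(norm (line_projection_deriv z u))\<^sup>2
    = 2 * ((norm z)\<^sup>2 * (norm u)\<^sup>2 - (norm (herm u z))\<^sup>2) / ((norm z)\<^sup>2)\<^sup>2"
proof -
  define N where "N = (norm z)\<^sup>2"
  define \<alpha> where "\<alpha> = herm u z / of_real N"
  define e where "e = u - \<alpha> *s z"
  have N: "N > 0" using assms by (simp add: N_def)
  have zz: "z \<bullet> z = N" by (simp add: N_def power2_norm_eq_inner)
  have Re\<alpha>: "z \<bullet> u = N * Re \<alpha>" using N by (simp add: \<alpha>_def Re_herm[symmetric] Re_divide_of_real)
  have e0: "herm e z = 0" and e2: "N * (norm e)\<^sup>2 = N * (norm u)\<^sup>2 - (norm (herm u z))\<^sup>2"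
    using norm_perp_component[OF assms, of u] by (simp_all add: e_def \<alpha>_def N_def)
  \<comment> \<open>The part \<alpha> z of \<open>u\<close> adds (\<alpha> + cnj \<alpha>) z z^* /
    N, which the derivative of the normalizing factor cancels.\<close>
  have M: "line_projection_deriv z u $ a $ b = (e $ a * cnj (z $ b) + z $ a * cnj (e $ b)) /\<^sub>R N" for a b
  proof -
    have *: "2 * of_real (Re \<alpha>) = \<alpha> + cnj \<alpha>" by (simp add: complex_eq_iff)
    have "(2 * (N * Re \<alpha>) / N\<^sup>2) *\<^sub>R (z $ a * cnj (z $ b))
        = ((\<alpha> + cnj \<alpha>) * (z $ a * cnj (z $ b))) /\<^sub>R N"
      unfolding *[symmetric] using N by (simp add: scaleR_conv_of_real power2_eq_square field_simps)
    then show ?thesis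
      unfolding line_projection_deriv_def e_def zz Re\<alpha>
      by (simp add: scaleR_diff_right[symmetric] algebra_simps)
  qed
  have sq: "(norm (x * cnj w + y * cnj v))\<^sup>2 = (norm x)\<^sup>2 * (norm w)\<^sup>2 + (norm y)\<^sup>2 * (norm v)\<^sup>2
      + 2 * Re ((x * cnj y) * (v * cnj w))" for x y v w :: complex
    by (simp only: cmod_power2) (simp add: power2_eq_square algebra_simps)
  have "(norm (line_projection_deriv z u))\<^sup>2
      = (\<Sum>a\<in>UNIV. \<Sum>b\<in>UNIV. (norm (line_projection_deriv z u $ a $ b))\<^sup>2)"
    by (simp add: norm_vec_def L2_set_def sum_nonneg)
  also have "\<dots> = (\<Sum>a\<in>UNIV. \<Sum>b\<in>UNIV. (norm (e $ a))\<^sup>2 * (norm (z $ b))\<^sup>2 + (norm (z $ a))\<^sup>2 * (norm (e $ b))\<^sup>2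
      + 2 * Re ((e $ a * cnj (z $ a)) * (e $ b * cnj (z $ b)))) / N\<^sup>2"
    by (simp only: M norm_scaleR power_mult_distrib sq)
      (use N in \<open>simp add: sum_divide_distrib power_inverse field_simps\<close>)
  also have "\<dots> = (2 * ((norm e)\<^sup>2 * N) + 2 * Re (herm e z * herm e z)) / N\<^sup>2"
    unfolding norm_power2_vec N_def herm_def sum_product Re_sum
    by (simp del: times_complex.sel add: sum.distrib sum_distrib_left[symmetric] sum_distrib_right[symmetric])
  finally show ?thesis using e0 e2 by (simp add: N_def mult_ac)
qed

text \<open>For the lifts, |z|^2 = 1 + |w|^2 and the Hermitian product loses its coordinate
  \<open>i\<close>, so the preceding formula turns into the Fubini-Study norm.\<close>

lemma norm_line_projection_deriv_homog:
  "norm (line_projection_deriv (homog i 1 w) (homog i 0 v)) = sqrt 2 * fs_norm w v"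
proof -
  let ?N = "1 + (norm w)\<^sup>2"
  have N: "0 < ?N" by (simp add: add_pos_nonneg)
  have 1: "(norm (homog i 1 w))\<^sup>2 = ?N" "(norm (homog i 0 v))\<^sup>2 = (norm v)\<^sup>2" "herm (homog i 0 v) (homog i 1 w) = herm v w"
    by (simp_all add: norm_power2_vec herm_def sum_homog_coords[of _ i] index_coord_coord_index)
  have R: "0 \<le> ?N * (norm v)\<^sup>2 - (norm (herm v w))\<^sup>2"
    using fs_norm_radicand_ge[of v w] zero_le_power2[of "norm v"] by linarith
  have "(norm (line_projection_deriv (homog i 1 w) (homog i 0 v)))\<^sup>2 = (sqrt 2 * fs_norm w v)\<^sup>2"
    by (subst norm_line_projection_deriv) (use R in \<open>simp_all add: 1 fs_norm_herm power_mult_distrib power_divide\<close>)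
  then show ?thesis by (rule power2_eq_imp_eq) (simp_all add: fs_norm_nonneg)
qed

section \<open>Lengths of curves\<close>

lemma continuous_on_line_projection_deriv:
  fixes z u :: "real \<Rightarrow> complex ^ 'n"
  assumes "continuous_on S z" "continuous_on S u" "\<And>t. t \<in> S \<Longrightarrow> z t \<noteq> 0"
  shows "continuous_on S (\<lambda>t. line_projection_deriv (z t) (u t))"
  unfolding line_projection_deriv_def
  by (intro continuous_on_vec_lambda continuous_intros assms) (use assms(3) in auto)

lemma has_vector_derivative_homog:
  assumes "(w has_vector_derivative v) (at t within S)"
  shows "((\<lambda>t. homog i s (w t)) has_vector_derivative homog i 0 v) (at t within S)"
  unfolding homog_def
proof (intro has_vector_derivative_vec_lambda)
  show "((\<lambda>t. if m = i then s else w t $ index_coord i m) has_vector_derivative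
      (if m = i then 0 else v $ index_coord i m)) (at t within S)" for m
    by (cases "m = i") (auto intro: has_vector_derivative_vec_nth[OF assms])
qed

lemma segre_chart: "x \<in> affine_open i \<Longrightarrow> segre x = line_projection (homog i 1 (chart i x))"
  by (subst chart_inv_chart[symmetric, of x i]) (simp_all add: chart_inv_homog segre_proj)

lemma has_vector_derivative_segre:
  assumes "((chart i \<circ> c) has_vector_derivative v) (at t within S)" "t \<in> S"
    and S: "\<And>s. s \<in> S \<Longrightarrow> c s \<in> affine_open i"
  shows "((segre \<circ> c) has_vector_derivative
      line_projection_deriv (homog i 1 (chart i (c t))) (homog i 0 v)) (at t within S)"
proof (rule has_vector_derivative_transform[OF \<open>t \<in> S\<close>])
  show "(segre \<circ> c) s = line_projection (homog i 1 ((chart i \<circ> c) s))" if "s \<in> S" for s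
    using S[OF that] by (simp add: segre_chart)
  show "((\<lambda>s. line_projection (homog i 1 ((chart i \<circ> c) s))) has_vector_derivative
      line_projection_deriv (homog i 1 (chart i (c t))) (homog i 0 v)) (at t within S)"
    using has_vector_derivative_line_projection[OF has_vector_derivative_homog[OF assms(1)], of i 1] by simp
qed

text \<open>Times spent in a chart domain are relatively open, so a derivative within them is a
  derivative within the whole interval; this is what lets chart derivatives be glued.\<close>

lemma at_within_affine_open:
  assumes "continuous_on T c" "t \<in> T" "c t \<in> affine_open i"
  shows "at t within {s\<in>T. c s \<in> affine_open i} = at t within T"
proof -
  obtain A where "open A" "A \<inter> T = c -` affine_open i \<inter> T"
    using assms(1) open_affine_open continuous_on_open_invariant by metis
  with assms(2,3) show ?thesis
    by (intro at_within_nhd[of t A]) auto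
qed

text \<open>The chart derivatives of \<open>c\<close> depend on the chart, but the embedded curve
  does not. Its derivative \<open>d\<close> is therefore defined on the whole interval, it is
  continuous because it is so near each time, and its norm reads off the Fubini-Study speed in every
  chart.\<close>

lemma smooth_curve_on_segre:
  assumes c: "smooth_curve_on {a..b} c"
  obtains d where "continuous_on {a..b} d"
    "\<And>t. t \<in> {a..b} \<Longrightarrow> ((segre \<circ> c) has_vector_derivative d t) (at t within {a..b})"
    "\<And>t i. t \<in> {a<..<b} \<Longrightarrow> c t \<in> affine_open i \<Longrightarrow>
       \<exists>v. ((chart i \<circ> c) has_vector_derivative v) (at t) \<and> norm (d t) = sqrt 2 * fs_norm (chart i (c t)) v"
proof
  define d where "d t = vector_derivative (segre \<circ> c) (at t within {a..b})" for t
  define S where "S i = {t\<in>{a..b}. c t \<in> affine_open i}" for i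
  have cont: "continuous_on {a..b} c" using c by (simp add: smooth_curve_on_def)
  have atS: "at t within S i = at t within {a..b}" if "t \<in> S i" for t i
    using at_within_affine_open[OF cont] that unfolding S_def by auto
  have "\<forall>i. smooth_on (S i) (chart i \<circ> c)" using c by (simp add: smooth_curve_on_def S_def)
  then have "\<forall>i. \<exists>G. (\<forall>t\<in>S i. G 0 t = (chart i \<circ> c) t) \<and>
        (\<forall>n. \<forall>t\<in>S i. (G n has_vector_derivative G (Suc n) t) (at t within S i))"
    unfolding smooth_on_def by blast
  from choice[OF this] obtain G where G0: "\<And>i t. t \<in> S i \<Longrightarrow> G i 0 t = (chart i \<circ> c) t"
    and G: "\<And>i n t. t \<in> S i \<Longrightarrow> (G i n has_vector_derivative G i (Suc n) t) (at t within S i)"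
    by blast
  have Gcont: "continuous_on (S i) (G i n)" for i n
    using G by (meson has_vector_derivative_continuous continuous_on_eq_continuous_within)
  have der: "((chart i \<circ> c) has_vector_derivative G i (Suc 0) t) (at t within S i)" if "t \<in> S i" for i t
    using G[OF that, of 0] by (rule has_vector_derivative_transform[OF that, rotated]) (simp add: G0)
  have seg: "((segre \<circ> c) has_vector_derivative
      line_projection_deriv (homog i 1 (chart i (c t))) (homog i 0 (G i (Suc 0) t))) (at t within {a..b})"
    if "t \<in> S i" for i t
    using has_vector_derivative_segre[OF der[OF that] that] atS[OF that] by (auto simp: S_def)
  have deq: "d t = line_projection_deriv (homog i 1 (chart i (c t))) (homog i 0 (G i (Suc 0) t))"
    if "t \<in> S i" "a < b" for i t
    unfolding d_def using seg[OF that(1)] that by (intro vector_derivative_within_closed_interval) (auto simp: S_def)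
  show dd: "((segre \<circ> c) has_vector_derivative d t) (at t within {a..b})" if "t \<in> {a..b}" for t
  proof -
    obtain i where "c t \<in> affine_open i" using affine_open_cover by blast
    with that have "t \<in> S i" by (simp add: S_def)
    from differentiableI_vector[OF seg[OF this]] show ?thesis
      unfolding d_def by (simp only: vector_derivative_works[symmetric])
  qed
  show "continuous_on {a..b} d"
  \<comment> \<open>Derivatives within the interval are unique only if it is nondegenerate;
    otherwise it has at most one point and continuity is trivial.\<close>
  proof (cases "a < b")
    case True
    show ?thesis unfolding continuous_on_eq_continuous_within
    proof
      fix t assume t: "t \<in> {a..b}"
      obtain i where "c t \<in> affine_open i" using affine_open_cover by blast
      with t have i: "t \<in> S i" by (simp add: S_def)
      have "continuous_on (S i) (\<lambda>t. line_projection_deriv (homog i 1 (G i 0 t)) (homog i 0 (G i (Suc 0) t)))"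
        by (intro continuous_on_line_projection_deriv continuous_on_compose2[OF continuous_homog] Gcont) auto
      then have "continuous_on (S i) d"
        by (rule continuous_on_cong[THEN iffD1, rotated 2]) (auto simp: deq[OF _ True] G0)
      then show "continuous (at t within {a..b}) d"
        using i by (simp add: continuous_on_eq_continuous_within atS[symmetric])
    qed
  next
    case False
    then have "{a..b} = {} \<or> {a..b} = {a}" by auto
    then show ?thesis by (auto simp: continuous_on_sing)
  qed
  show "\<exists>v. ((chart i \<circ> c) has_vector_derivative v) (at t) \<and> norm (d t) = sqrt 2 * fs_norm (chart i (c t)) v"
    if t: "t \<in> {a<..<b}" "c t \<in> affine_open i" for t i
  proof -
    have tS: "t \<in> S i" using t by (auto simp: S_def)
    have "at t within {a..b} = at t"
      using t by (intro at_within_open_subset[of t "{a<..<b}"]) auto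
    then show ?thesis using der[OF tS] atS[OF tS] deq[OF tS] t
      by (auto simp: norm_line_projection_deriv_homog)
  qed
qed

text \<open>\<open>fs_speed\<close> differentiates within the unit interval and in a chart that
  varies with time; at interior points of a piece the embedded curve removes both choices. The chord
  is bounded by the length through the fundamental theorem of calculus for the embedded
  curve.\<close>

lemma smooth_piece:
  assumes c: "smooth_curve_on {a..b} c" and ab: "a < b" "0 \<le> a" "b \<le> 1"
  shows smooth_piece_chart: "\<And>t i. t \<in> {a<..<b} \<Longrightarrow> c t \<in> affine_open i \<Longrightarrow>
      \<exists>v. ((chart i \<circ> c) has_vector_derivative v) (at t) \<and> fs_speed c t = fs_norm (chart i (c t)) v"
    and smooth_piece_segre: "\<And>t. t \<in> {a<..<b} \<Longrightarrow>
      (segre \<circ> c) differentiable at t \<and> sqrt 2 * fs_speed c t = norm (vector_derivative (segre \<circ> c) (at t))"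
    and smooth_piece_integrable: "fs_speed c integrable_on {a..b}"
    and smooth_piece_length: "norm (segre (c b) - segre (c a)) \<le> sqrt 2 * integral {a..b} (fs_speed c)"
proof -
  obtain d where d: "continuous_on {a..b} d"
    "\<And>t. t \<in> {a..b} \<Longrightarrow> ((segre \<circ> c) has_vector_derivative d t) (at t within {a..b})"
    "\<And>t i. t \<in> {a<..<b} \<Longrightarrow> c t \<in> affine_open i \<Longrightarrow>
       \<exists>v. ((chart i \<circ> c) has_vector_derivative v) (at t) \<and> norm (d t) = sqrt 2 * fs_norm (chart i (c t)) v"
    using smooth_curve_on_segre[OF c] by metis
  have speed: "sqrt 2 * fs_speed c t = norm (d t)" if t: "t \<in> {a<..<b}" for t
  proof -
    obtain v where v: "((chart (chart_at (c t)) \<circ> c) has_vector_derivative v) (at t)"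
        "norm (d t) = sqrt 2 * fs_norm (chart (chart_at (c t)) (c t)) v"
      using d(3)[OF t in_affine_open_chart_at] by blast
    have "at t within {0..1} = at t"
      using t ab by (intro at_within_open_subset[of t "{a<..<b}"]) auto
    with v show ?thesis
      by (simp add: fs_speed_def Let_def vector_derivative_at)
  qed
  show "\<exists>v. ((chart i \<circ> c) has_vector_derivative v) (at t) \<and> fs_speed c t = fs_norm (chart i (c t)) v"
    if t: "t \<in> {a<..<b}" "c t \<in> affine_open i" for t i
    using d(3)[OF that] speed[OF t(1)] by auto
  show "(segre \<circ> c) differentiable at t \<and> sqrt 2 * fs_speed c t = norm (vector_derivative (segre \<circ> c) (at t))"
    if t: "t \<in> {a<..<b}" for t
  proof -
    have "at t within {a..b} = at t"
      using t by (intro at_within_open_subset[of t "{a<..<b}"]) auto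
    then have "((segre \<circ> c) has_vector_derivative d t) (at t)" using d(2)[of t] t by auto
    from differentiableI_vector[OF this] vector_derivative_at[OF this] speed[OF t] show ?thesis by simp
  qed
  have dn: "(\<lambda>t. norm (d t)) integrable_on {a..b}"
    using d(1) by (intro integrable_continuous_real continuous_intros)
  have speed': "sqrt 2 * fs_speed c t = norm (d t)" if "t \<in> {a..b} - {a, b}" for t
    using speed[of t] that by auto
  \<comment> \<open>At the two ends of the piece the speed is uncontrolled, as neighbouring pieces
    may meet at a corner; two points are negligible for the integral.\<close>
  have I: "(\<lambda>t. sqrt 2 * fs_speed c t) integrable_on {a..b}"
    by (rule integrable_spike_finite[where S="{a, b}", OF _ _ dn]) (use speed' in simp_all)
  from integrable_on_cmult_left[OF I, of "1 / sqrt 2"] show I': "fs_speed c integrable_on {a..b}" by simp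
  have "norm (integral {a..b} d) \<le> integral {a..b} (\<lambda>t. norm (d t))"
    by (rule Henstock_Kurzweil_Integration.integral_norm_bound_integral[OF integrable_continuous_real[OF d(1)] dn]) simp
  also have "\<dots> = integral {a..b} (\<lambda>t. sqrt 2 * fs_speed c t)"
    by (rule integral_spike[OF negligible_finite[of "{a, b}"]]) (use speed' in simp_all)
  also have "integral {a..b} d = segre (c b) - segre (c a)"
    using fundamental_theorem_of_calculus[of a b "segre \<circ> c" d] d(2) ab by (auto intro: integral_unique)
  finally show "norm (segre (c b) - segre (c a)) \<le> sqrt 2 * integral {a..b} (fs_speed c)" by simp
qed

lemma increasing_steps:
  fixes s :: "nat \<Rightarrow> real"
  assumes "\<forall>j<m. s j < s (Suc j)" "j \<le> k" "k \<le> m"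
  shows "s j \<le> s k"
  using assms(2,3)
proof (induction k rule: dec_induct)
  case (step n)
  then show ?case using assms(1) by (meson Suc_leD Suc_le_lessD less_eq_real_def order_trans)
qed simp

text \<open>Induction over the pieces: integrals add up, chords obey the triangle inequality, and
  \<open>F\<close> collects the break times, including 0 and 1.\<close>

lemma piecewise_smooth_path_segre:
  assumes "piecewise_smooth_path c"
  obtains F where "finite F"
    "\<And>t. t \<in> {0..1} - F \<Longrightarrow> t \<in> {0<..<1} \<and> (segre \<circ> c) differentiable at t \<and>
       sqrt 2 * fs_speed c t = norm (vector_derivative (segre \<circ> c) (at t))"
    "fs_speed c integrable_on {0..1}"
    "norm (segre (c 1) - segre (c 0)) \<le> sqrt 2 * fs_length c"
proof -
  obtain m :: nat and s where s: "s 0 = 0" "s m = 1"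
    and sj: "\<And>j. j < m \<Longrightarrow> s j < s (Suc j) \<and> smooth_curve_on {s j..s (Suc j)} c"
    using assms unfolding piecewise_smooth_path_def by blast
  have mono: "s j \<le> s k" if "j \<le> k" "k \<le> m" for j k
    using increasing_steps[of m s] sj that by blast
  have "j \<le> m \<Longrightarrow> \<exists>F. finite F \<and> (\<forall>t\<in>{0..s j} - F. t \<in> {0<..<1} \<and> (segre \<circ> c) differentiable at t \<and>
       sqrt 2 * fs_speed c t = norm (vector_derivative (segre \<circ> c) (at t))) \<and>
       fs_speed c integrable_on {0..s j} \<and>
       norm (segre (c (s j)) - segre (c 0)) \<le> sqrt 2 * integral {0..s j} (fs_speed c)" for j
  proof (induction j)
    case 0
    have "fs_speed c integrable_on {0..0}"
      using integrable_on_refl[of "fs_speed c" 0] by (simp only: box_real)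
    then show ?case by (auto simp: s intro!: exI[of _ "{0}"])
  next
    case (Suc j)
    then have "j \<le> m" by simp
    from Suc.IH[OF this] obtain F where F: "finite F" and Fd: "\<And>t. t \<in> {0..s j} - F \<Longrightarrow> t \<in> {0<..<1} \<and> (segre \<circ> c) differentiable at t \<and>
       sqrt 2 * fs_speed c t = norm (vector_derivative (segre \<circ> c) (at t))"
       and I: "fs_speed c integrable_on {0..s j}"
       and L: "norm (segre (c (s j)) - segre (c 0)) \<le> sqrt 2 * integral {0..s j} (fs_speed c)"
      by blast
    have 0: "0 \<le> s j" and 1: "s (Suc j) \<le> 1" using mono[of 0 j] mono[of "Suc j" m] s Suc.prems by auto
    have lt: "s j < s (Suc j)" and sm: "smooth_curve_on {s j..s (Suc j)} c" using sj[of j] Suc.prems by auto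
    note P = smooth_piece[OF sm lt 0 1]
    have I': "fs_speed c integrable_on {0..s (Suc j)}"
      by (rule Henstock_Kurzweil_Integration.integrable_combine[OF 0 _ I P(3)]) (use lt in auto)
    have "integral {0..s (Suc j)} (fs_speed c) = integral {0..s j} (fs_speed c) + integral {s j..s (Suc j)} (fs_speed c)"
      by (rule Henstock_Kurzweil_Integration.integral_combine[symmetric, OF 0 _ I']) (use lt in auto)
    moreover have "norm (segre (c (s (Suc j))) - segre (c 0))
        \<le> norm (segre (c (s (Suc j))) - segre (c (s j))) + norm (segre (c (s j)) - segre (c 0))"
      using norm_triangle_ineq[of "segre (c (s (Suc j))) - segre (c (s j))" "segre (c (s j)) - segre (c 0)"] by simp
    ultimately have L': "norm (segre (c (s (Suc j))) - segre (c 0)) \<le> sqrt 2 * integral {0..s (Suc j)} (fs_speed c)"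
      using L P(4) by (simp add: distrib_left)
    have "t \<in> {0<..<1} \<and> (segre \<circ> c) differentiable at t \<and>
       sqrt 2 * fs_speed c t = norm (vector_derivative (segre \<circ> c) (at t))"
      if "t \<in> {0..s (Suc j)} - (F \<union> {s j, s (Suc j)})" for t
    proof (cases "t \<le> s j")
      case True
      then show ?thesis using Fd[of t] that by auto
    next
      case False
      then have "t \<in> {s j<..<s (Suc j)}" using that by auto
      with P(2)[OF this] 0 1 show ?thesis by auto
    qed
    moreover have "finite (F \<union> {s j, s (Suc j)})" using F by simp
    ultimately show ?case using I' L' by blast
  qed
  from this[of m] show ?thesis using that by (auto simp: s fs_length_def)
qed

lemma fs_length_nonneg:
  assumes "piecewise_smooth_path c" shows "0 \<le> fs_length c"
proof -
  obtain F where "norm (segre (c 1) - segre (c 0)) \<le> sqrt 2 * fs_length c"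
    by (rule piecewise_smooth_path_segre[OF assms])
  then have "0 \<le> sqrt 2 * fs_length c" by (rule order_trans[OF norm_ge_zero])
  then show ?thesis by (simp add: zero_le_mult_iff)
qed

section \<open>Concatenation\<close>

text \<open>By the chain rule each derivative gains a factor \<open>m\<close>, so the tower of
  derivatives of the reparametrized curve is m^n times that of \<open>g\<close>.\<close>

lemma smooth_on_affine:
  assumes "smooth_on S g" "\<And>t. t \<in> T \<Longrightarrow> m * t + k \<in> S" "\<And>t. t \<in> T \<Longrightarrow> g' t = g (m * t + k)"
  shows "smooth_on T g'"
proof -
  obtain G where G0: "\<And>t. t\<in>S \<Longrightarrow> G 0 t = g t"
    and G: "\<And>n t. t\<in>S \<Longrightarrow> (G n has_vector_derivative G (Suc n) t) (at t within S)"
    using assms(1) unfolding smooth_on_def by blast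
  have "((\<lambda>t. m ^ n *\<^sub>R G n (m * t + k)) has_vector_derivative m ^ Suc n *\<^sub>R G (Suc n) (m * t + k)) (at t within T)"
    if t: "t \<in> T" for n t
  proof -
    have f: "((\<lambda>t. m * t + k) has_vector_derivative m) (at t within T)"
      by (auto intro!: derivative_eq_intros)
    have g: "(G n has_vector_derivative G (Suc n) (m * t + k)) (at (m * t + k) within (\<lambda>t. m * t + k) ` T)"
      using G[OF assms(2)[OF t]] by (rule has_vector_derivative_within_subset) (use assms(2) in auto)
    from has_vector_derivative_scaleR[OF DERIV_const[of "m ^ n"] vector_diff_chain_within[OF f g]]
    show ?thesis by (simp add: comp_def mult_ac)
  qed
  then show ?thesis unfolding smooth_on_def
    by (intro exI[of _ "\<lambda>n t. m ^ n *\<^sub>R G n (m * t + k)"]) (simp add: G0 assms)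
qed

lemma smooth_curve_on_affine:
  assumes c: "smooth_curve_on S c" and S: "\<And>t. t \<in> T \<Longrightarrow> m * t + k \<in> S"
    and c': "\<And>t. t \<in> T \<Longrightarrow> c' t = c (m * t + k)"
  shows "smooth_curve_on T c'"
  unfolding smooth_curve_on_def
proof (intro conjI allI)
  have "continuous_on S c" using c by (simp add: smooth_curve_on_def)
  moreover have "continuous_on T (\<lambda>t. m * t + k)" by (intro continuous_intros)
  ultimately have "continuous_on T (\<lambda>t. c (m * t + k))"
    by (rule continuous_on_compose2) (use S in blast)
  then show "continuous_on T c'"
    by (rule continuous_on_cong[THEN iffD1, OF refl, rotated]) (simp only: c')
  fix i
  have "smooth_on {t\<in>S. c t \<in> affine_open i} (chart i \<circ> c)" using c by (simp add: smooth_curve_on_def)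
  then show "smooth_on {t\<in>T. c' t \<in> affine_open i} (chart i \<circ> c')"
  proof (rule smooth_on_affine[where m=m and k=k])
    fix t assume "t \<in> {t\<in>T. c' t \<in> affine_open i}"
    then have t: "t \<in> T" "c' t \<in> affine_open i" by auto
    show "m * t + k \<in> {t\<in>S. c t \<in> affine_open i}" using t(2) S[OF t(1)] by (simp add: c'[OF t(1)])
    show "(chart i \<circ> c') t = (chart i \<circ> c) (m * t + k)" by (simp add: c'[OF t(1)])
  qed
qed

lemma piecewise_smooth_path_join:
  assumes "piecewise_smooth_path c1" "piecewise_smooth_path c2" "c1 1 = c2 0"
  shows "piecewise_smooth_path (c1 +++ c2)"
proof -
  obtain m1 :: nat and s1 where s1: "s1 0 = 0" "s1 m1 = 1"
    and sj1: "\<And>j. j < m1 \<Longrightarrow> s1 j < s1 (Suc j) \<and> smooth_curve_on {s1 j..s1 (Suc j)} c1"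
    using assms(1) unfolding piecewise_smooth_path_def by blast
  obtain m2 :: nat and s2 where s2: "s2 0 = 0" "s2 m2 = 1"
    and sj2: "\<And>j. j < m2 \<Longrightarrow> s2 j < s2 (Suc j) \<and> smooth_curve_on {s2 j..s2 (Suc j)} c2"
    using assms(2) unfolding piecewise_smooth_path_def by blast
  have le1: "s1 j \<le> 1" if "j \<le> m1" for j
    using increasing_steps[of m1 s1 j m1] sj1 that s1 by simp
  have ge2: "0 \<le> s2 j" if "j \<le> m2" for j
    using increasing_steps[of m2 s2 0 j] sj2 that s2 by simp
  \<comment> \<open>The break times of \<open>c1\<close> fill the first half and those of
    \<open>c2\<close> the second; at \<open>j = m1\<close> both formulas give 1/2, which
    \<open>s_right\<close> records.\<close>
  define s where "s j = (if j \<le> m1 then s1 j / 2 else (1 + s2 (j - m1)) / 2)" for j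
  have s_right: "s j = (1 + s2 (j - m1)) / 2" if "m1 \<le> j" for j
    using that by (cases "j = m1") (auto simp: s_def s1 s2)
  have "s j < s (Suc j) \<and> smooth_curve_on {s j..s (Suc j)} (c1 +++ c2)" if j: "j < m1 + m2" for j
  proof (cases "j < m1")
    case True
    then have sj: "s j = s1 j / 2" "s (Suc j) = s1 (Suc j) / 2" by (auto simp: s_def)
    have "smooth_curve_on {s j..s (Suc j)} (c1 +++ c2)"
    proof (rule smooth_curve_on_affine[where m=2 and k=0])
      show "smooth_curve_on {s1 j..s1 (Suc j)} c1" using sj1 True by blast
      show "(c1 +++ c2) t = c1 (2 * t + 0)" if "t \<in> {s j..s (Suc j)}" for t
        using that le1[of "Suc j"] True by (auto simp: joinpaths_def sj)
    qed (auto simp: sj)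
    then show ?thesis using sj1[OF True] by (simp add: sj)
  next
    case False
    then have sj: "s j = (1 + s2 (j - m1)) / 2" "s (Suc j) = (1 + s2 (Suc (j - m1))) / 2"
      using s_right[of j] s_right[of "Suc j"] by (auto simp: Suc_diff_le)
    have j2: "j - m1 < m2" using j False by auto
    have "smooth_curve_on {s j..s (Suc j)} (c1 +++ c2)"
    proof (rule smooth_curve_on_affine[where m=2 and k="-1"])
      show "smooth_curve_on {s2 (j - m1)..s2 (Suc (j - m1))} c2" using sj2 j2 by blast
      show "(c1 +++ c2) t = c2 (2 * t + (-1))" if "t \<in> {s j..s (Suc j)}" for t
      proof -
        have "t \<ge> 1/2" using that ge2[of "j - m1"] j2 by (auto simp: sj)
        show ?thesis
        proof (cases "t = 1/2")
          case True
          \<comment> \<open>At the midpoint \<open>+++\<close> takes its value from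
            \<open>c1\<close>, so the matching of end points enters here.\<close>
          show ?thesis unfolding True using assms(3) by (simp add: joinpaths_def)
        qed (use \<open>t \<ge> 1/2\<close> in \<open>auto simp: joinpaths_def\<close>)
      qed
    qed (auto simp: sj)
    then show ?thesis using sj2[OF j2] by (simp add: sj)
  qed
  moreover have "s 0 = 0" "s (m1 + m2) = 1" using s_right[of "m1 + m2"] by (auto simp: s_def s1 s2)
  ultimately show ?thesis unfolding piecewise_smooth_path_def by blast
qed

text \<open>Speeds are compared through the embedded curves, whose derivatives obey the chain rule
  without any chart. Off finitely many times, among them the midpoint, the speed on each half is
  twice the reparametrized speed, and substitution in the integral finishes.\<close>

lemma fs_length_join:
  assumes c1: "piecewise_smooth_path c1" and c2: "piecewise_smooth_path c2" and "c1 1 = c2 0"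
  shows "fs_length (c1 +++ c2) = fs_length c1 + fs_length c2"
proof -
  let ?g1 = "segre \<circ> c1" and ?g2 = "segre \<circ> c2" and ?c = "c1 +++ c2"
  let ?V = "\<lambda>g t. vector_derivative g (at t)"
  obtain F1 where F1: "finite F1" 
    "\<And>t. t \<in> {0..1} - F1 \<Longrightarrow> ?g1 differentiable at t \<and> sqrt 2 * fs_speed c1 t = norm (?V ?g1 t)"
    and I1: "fs_speed c1 integrable_on {0..1}"
    by (rule piecewise_smooth_path_segre[OF c1]) blast
  obtain F2 where F2: "finite F2"
    "\<And>t. t \<in> {0..1} - F2 \<Longrightarrow> ?g2 differentiable at t \<and> sqrt 2 * fs_speed c2 t = norm (?V ?g2 t)"
    and I2: "fs_speed c2 integrable_on {0..1}"
    by (rule piecewise_smooth_path_segre[OF c2]) blast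
  obtain F where F: "finite F"
    "\<And>t. t \<in> {0..1} - F \<Longrightarrow> sqrt 2 * fs_speed ?c t = norm (?V (segre \<circ> ?c) t)"
    by (rule piecewise_smooth_path_segre[OF piecewise_smooth_path_join[OF assms]]) blast
  have i1: "((\<lambda>t. 2 * fs_speed c1 (2*t)) has_integral fs_length c1) {0..1/2}"
   and i2: "((\<lambda>t. 2 * fs_speed c2 (2*t - 1)) has_integral fs_length c2) {1/2..1}"
    using has_integral_affinity01 [OF integrable_integral[OF I1], where m= 2 and c=0, THEN has_integral_cmul [where c=2]]
          has_integral_affinity01 [OF integrable_integral[OF I2], where m= 2 and c="-1", THEN has_integral_cmul [where c=2]]
    by (simp_all only: image_affinity_atLeastAtMost_div_diff, simp_all add: fs_length_def)
  have s1: "fs_speed ?c t = 2 * fs_speed c1 (2 * t)" if "t \<in> {0..1/2} - (insert (1/2) ((*) 2 -` F1) \<union> F)" for t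
  proof -
    have "2 * t \<in> {0..1} - F1" using that by auto
    then have g1: "(?g1 has_vector_derivative ?V ?g1 (2 * t)) (at (2 * t))"
      and n1: "sqrt 2 * fs_speed c1 (2 * t) = norm (?V ?g1 (2 * t))"
      using F1(2) vector_derivative_works by blast+
    have "((*) 2 has_vector_derivative 2) (at t)" by (auto intro!: derivative_eq_intros)
    from vector_diff_chain_at[OF this g1]
    have "((segre \<circ> ?c) has_vector_derivative 2 *\<^sub>R ?V ?g1 (2 * t)) (at t)"
    proof (rule has_vector_derivative_transform_within_open[of _ _ _ "{..<1/2}"])
      show "(?g1 \<circ> (*) 2) x = (segre \<circ> ?c) x" if "x \<in> {..<1/2}" for x
        using that by (auto simp: joinpaths_def)
    qed (use that in auto)
    from vector_derivative_at[OF this] F(2)[of t] that n1 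
    have "sqrt 2 * fs_speed ?c t = sqrt 2 * (2 * fs_speed c1 (2 * t))" by simp
    then show ?thesis by simp
  qed
  have s2: "fs_speed ?c t = 2 * fs_speed c2 (2 * t - 1)" if "t \<in> {1/2..1} - (insert (1/2) ((\<lambda>t. 2 * t - 1) -` F2) \<union> F)" for t
  proof -
    have "2 * t - 1 \<in> {0..1} - F2" using that by auto
    then have g2: "(?g2 has_vector_derivative ?V ?g2 (2 * t - 1)) (at (2 * t - 1))"
      and n2: "sqrt 2 * fs_speed c2 (2 * t - 1) = norm (?V ?g2 (2 * t - 1))"
      using F2(2) vector_derivative_works by blast+
    have "((\<lambda>t. 2 * t - 1) has_vector_derivative 2) (at t)" by (auto intro!: derivative_eq_intros)
    from vector_diff_chain_at[OF this g2]
    have "((segre \<circ> ?c) has_vector_derivative 2 *\<^sub>R ?V ?g2 (2 * t - 1)) (at t)"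
    proof (rule has_vector_derivative_transform_within_open[of _ _ _ "{1/2<..}"])
      show "(?g2 \<circ> (\<lambda>t. 2 * t - 1)) x = (segre \<circ> ?c) x" if "x \<in> {1/2<..}" for x
        using that by (auto simp: joinpaths_def)
    qed (use that in auto)
    from vector_derivative_at[OF this] F(2)[of t] that n2
    have "sqrt 2 * fs_speed ?c t = sqrt 2 * (2 * fs_speed c2 (2 * t - 1))" by simp
    then show ?thesis by simp
  qed
  have "finite ((*) 2 -` F1)" "finite ((\<lambda>t. 2 * t - 1) -` F2)"
    by (intro finite_vimageI F1 F2 inj_onI; simp)+
  then have fin: "finite (insert (1/2) ((*) 2 -` F1) \<union> F)" "finite (insert (1/2) ((\<lambda>t. 2 * t - 1) -` F2) \<union> F)"
    using F(1) by auto
  have "(fs_speed ?c has_integral fs_length c1) {0..1/2}"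
    by (rule has_integral_spike_finite[OF fin(1) s1 i1])
  moreover have "(fs_speed ?c has_integral fs_length c2) {1/2..1}"
    by (rule has_integral_spike_finite[OF fin(2) s2 i2])
  ultimately have "(fs_speed ?c has_integral fs_length c1 + fs_length c2) {0..1}"
    by (rule has_integral_combine[rotated 2]) auto
  then show ?thesis by (simp add: fs_length_def integral_unique)
qed

section \<open>Holomorphic curves\<close>

text \<open>One complex derivative yields all higher ones; restricted to real parameters they form
  the tower of derivatives required by \<open>smooth_on\<close>.\<close>

lemma smooth_on_holomorphic:
  fixes g :: "complex \<Rightarrow> complex ^ 'n"
  assumes "open U" "\<And>j. (\<lambda>s. g s $ j) holomorphic_on U" "\<And>t. t \<in> S \<Longrightarrow> of_real t \<in> U"
  shows "smooth_on S (\<lambda>t. g (of_real t))"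
  unfolding smooth_on_def
proof (intro exI conjI ballI allI)
  let ?G = "\<lambda>n t. \<chi> j. (deriv ^^ n) (\<lambda>s. g s $ j) (complex_of_real t)"
  show "?G 0 t = g (of_real t)" for t by simp
  show "(?G n has_vector_derivative ?G (Suc n) t) (at t within S)" if "t \<in> S" for n t
    by (intro has_vector_derivative_vec_lambda has_vector_derivative_real_field
        has_field_derivative_higher_deriv[OF assms(2,1) assms(3)[OF that]])
qed

text \<open>The curve is extended to complex parameters so that smoothness of every order follows
  from a single complex derivative in charts.\<close>

lemma smooth_curve_on_holomorphic:
  fixes \<zeta> :: "complex \<Rightarrow> 'k::finite cproj"
  assumes "open U" and cont: "continuous_on U \<zeta>"
    and hol: "\<And>i j s. s \<in> U \<Longrightarrow> \<zeta> s \<in> affine_open i \<Longrightarrow> (\<lambda>s. chart i (\<zeta> s) $ j) field_differentiable at s"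
    and S: "\<And>t. t \<in> S \<Longrightarrow> of_real t \<in> U"
  shows "smooth_curve_on S (\<lambda>t. \<zeta> (of_real t))"
  unfolding smooth_curve_on_def
proof (intro conjI allI)
  have "continuous_on S (of_real :: real \<Rightarrow> complex)" by (intro continuous_intros)
  then show "continuous_on S (\<lambda>t. \<zeta> (of_real t))"
    by (rule continuous_on_compose2[OF cont]) (use S in blast)
  fix i
  let ?U = "U \<inter> \<zeta> -` affine_open i"
  have "open ?U" using continuous_open_preimage[OF cont \<open>open U\<close> open_affine_open] .
  then have "smooth_on {t\<in>S. \<zeta> (of_real t) \<in> affine_open i} (\<lambda>t. (\<lambda>s. chart i (\<zeta> s)) (of_real t))"
    by (rule smooth_on_holomorphic) (use S hol in \<open>auto simp: holomorphic_on_def intro: field_differentiable_at_within\<close>)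
  then show "smooth_on {t\<in>S. \<zeta> (of_real t) \<in> affine_open i} (chart i \<circ> (\<lambda>t. \<zeta> (of_real t)))"
    by (simp add: comp_def)
qed

lemma smooth_curve_piecewise:
  assumes "smooth_curve_on {0..1} c" shows "piecewise_smooth_path c"
  unfolding piecewise_smooth_path_def
  by (rule exI[of _ 1], rule exI[of _ real]) (use assms in simp)

lemma fs_length_le:
  assumes "smooth_curve_on {0..1} c" "\<And>t. t \<in> {0<..<1} \<Longrightarrow> fs_speed c t \<le> B"
  shows "fs_length c \<le> B"
proof -
  have "fs_speed c integrable_on {0..1}" by (rule smooth_piece_integrable[OF assms(1)]) auto
  \<comment> \<open>The speed is bounded on the open interval only; the end points do not affect the
    integral.\<close>
  then have "integral {0<..<1} (fs_speed c) \<le> integral {0<..<1::real} (\<lambda>_. B)"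
    by (intro Henstock_Kurzweil_Integration.integral_le)
      (simp_all add: assms(2) integrable_on_open_interval_real integrable_const_ivl)
  then show ?thesis by (simp add: fs_length_def integral_open_interval_real[symmetric])
qed

lemma scaleR_vec_conv_of_real: "t *\<^sub>R v = complex_of_real t *s (v :: complex ^ 'n)"
  by (simp add: vec_eq_iff scaleR_conv_of_real[where 'a=complex])

lemma has_derivative_complex_line:
  fixes w v :: "complex ^ 'n"
  shows "((\<lambda>s. w + s *s v) has_derivative (\<lambda>h. h *s v)) (at s)"
proof -
  have "linear (\<lambda>h::complex. h *s v)"
    by (rule linearI) (simp_all add: vec_eq_iff distrib_right)
  then have "bounded_linear (\<lambda>h. h *s v)" by (simp add: linear_conv_bounded_linear)
  from has_derivative_add[OF has_derivative_const[of w] bounded_linear_imp_has_derivative[OF this]]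
  show ?thesis by simp
qed

lemma continuous_on_complex_line: "continuous_on S (\<lambda>s. w + s *s (v :: complex ^ 'n))"
  by (intro continuous_at_imp_continuous_on ballI has_derivative_continuous[OF has_derivative_complex_line])

text \<open>The segment extends to a complex line, on which every other chart is a quotient of
  affine functions, hence holomorphic where defined. In the chart \<open>i\<close> itself the curve
  has the constant derivative \<open>w' - w\<close>.\<close>

lemma chart_segment:
  fixes w w' :: "complex ^ 'k::finite" and i
  defines "c \<equiv> \<lambda>t. chart_inv i (w + t *\<^sub>R (w' - w))"
  shows "smooth_curve_on {0..1} c" "fs_length c \<le> norm (w' - w)"
proof -
  let ?l = "\<lambda>s::complex. w + s *s (w' - w)"
  have "smooth_curve_on {0..1} (\<lambda>t. (\<lambda>s. chart_inv i (?l s)) (of_real t))"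
  proof (rule smooth_curve_on_holomorphic[OF open_UNIV])
    show "continuous_on UNIV (\<lambda>s. chart_inv i (?l s))"
      by (rule continuous_on_compose2[OF continuous_chart_inv continuous_on_complex_line]) simp
    fix j m s assume "chart_inv i (?l s) \<in> affine_open j"
    then have nz: "homog i 1 (?l s) $ j \<noteq> 0"
      by (subst (asm) chart_inv_homog, subst (asm) affine_open_proj) auto
    have "(\<lambda>s. homog i 1 (?l s) $ n) field_differentiable at s" for n
      by (cases "n = i") (auto intro!: derivative_intros)
    then have "(\<lambda>s. homog i 1 (?l s) $ coord_index j m / homog i 1 (?l s) $ j) field_differentiable at s"
      using nz by (intro field_differentiable_divide)
    then show "(\<lambda>s. chart j (chart_inv i (?l s)) $ m) field_differentiable at s"
      by (simp only: chart_inv_homog chart_proj[OF homog_1_nonzero] vec_lambda_beta)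
  qed auto
  then show c: "smooth_curve_on {0..1} c" by (simp only: c_def scaleR_vec_conv_of_real)
  show "fs_length c \<le> norm (w' - w)"
  proof (rule fs_length_le[OF c])
    fix t :: real assume t: "t \<in> {0<..<1}"
    have "c t \<in> affine_open i" by (simp add: c_def chart_inv_in_affine)
    with smooth_piece_chart[OF c _ _ _ t] obtain v
      where v: "((chart i \<circ> c) has_vector_derivative v) (at t)" "fs_speed c t = fs_norm (chart i (c t)) v"
      by auto
    have "chart i \<circ> c = (\<lambda>t. w + t *\<^sub>R (w' - w))" by (auto simp: c_def chart_chart_inv)
    then have "((chart i \<circ> c) has_vector_derivative (w' - w)) (at t)"
      by (auto intro!: derivative_eq_intros)
    with v(1) have "v = w' - w" by (rule vector_derivative_unique_at)
    then show "fs_speed c t \<le> norm (w' - w)" by (simp add: v(2) fs_norm_le_norm)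
  qed
qed

section \<open>The Fubini--Study distance\<close>

lemma chart_path:
  obtains c where "piecewise_smooth_path c" "c 0 = chart_inv i w" "c 1 = chart_inv i w'"
    "fs_length c \<le> norm (w' - w)"
  by (rule that[of "\<lambda>t. chart_inv i (w + t *\<^sub>R (w' - w))"])
    (auto intro: smooth_curve_piecewise chart_segment)

text \<open>Ensures that the infimum in \<open>fs_dist\<close> runs over a nonempty set, so that
  lower bounds for lengths pass to it.\<close>

lemma path_exists:
  fixes p q :: "'k::finite cproj"
  obtains c where "piecewise_smooth_path c" "c 0 = p" "c 1 = q"
proof -
  \<comment> \<open>The point with all homogeneous coordinates 1 lies in every chart, so two chart
    segments through it join \<open>p\<close> to \<open>q\<close>.\<close>
  define z :: "complex ^ 'k option" where "z = 1"
  have z: "proj z \<in> affine_open i" for i by (subst affine_open_proj) (auto simp: z_def)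
  obtain i j where ij: "p \<in> affine_open i" "q \<in> affine_open j" using affine_open_cover by metis
  obtain c1 where c1: "piecewise_smooth_path c1" "c1 0 = p" "c1 1 = proj z"
    using chart_path[of i "chart i p" "chart i (proj z)"] by (metis chart_inv_chart ij(1) z)
  obtain c2 where c2: "piecewise_smooth_path c2" "c2 0 = proj z" "c2 1 = q"
    using chart_path[of j "chart j (proj z)" "chart j q"] by (metis chart_inv_chart ij(2) z)
  show ?thesis
    by (rule that[OF piecewise_smooth_path_join[OF c1(1) c2(1)]]) (use c1 c2 in \<open>auto simp: joinpaths_def\<close>)
qed

lemma fs_dist_le:
  assumes "piecewise_smooth_path c" "c 0 = p" "c 1 = q" shows "fs_dist p q \<le> fs_length c"
  unfolding fs_dist_def
  by (rule cInf_lower) (use assms in \<open>auto intro!: bdd_belowI[of _ 0] fs_length_nonneg\<close>)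

lemma fs_dist_ge:
  assumes "\<And>c. piecewise_smooth_path c \<Longrightarrow> c 0 = p \<Longrightarrow> c 1 = q \<Longrightarrow> B \<le> fs_length c"
  shows "B \<le> fs_dist p q"
  unfolding fs_dist_def
  by (rule cInf_greatest) (use assms path_exists[of p q] in blast)+

lemma fs_dist_nonneg: "0 \<le> fs_dist p q"
  by (intro fs_dist_ge fs_length_nonneg)

text \<open>A chord is no longer than the embedded curve, whose length is sqrt 2 times the
  Fubini-Study length; then take the infimum over paths.\<close>

lemma segre_le_fs_dist: "norm (segre q - segre p) \<le> sqrt 2 * fs_dist p q"
proof -
  have "norm (segre q - segre p) / sqrt 2 \<le> fs_dist p q"
  proof (rule fs_dist_ge)
    fix c assume c: "piecewise_smooth_path c" "c 0 = p" "c 1 = q"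
    show "norm (segre q - segre p) / sqrt 2 \<le> fs_length c"
      by (rule piecewise_smooth_path_segre[OF c(1)]) (simp add: c divide_le_eq mult.commute)
  qed
  then show ?thesis by (simp add: divide_le_eq mult.commute)
qed

lemma fs_dist_chart_inv_le: "fs_dist (chart_inv i w) (chart_inv i w') \<le> norm (w' - w)"
  by (rule chart_path[of i w w']) (use fs_dist_le order_trans in blast)

lemma fs_dist_self [simp]: "fs_dist p p = 0"
proof -
  obtain i where "p \<in> affine_open i" using affine_open_cover by blast
  with fs_dist_chart_inv_le[of i "chart i p" "chart i p"] fs_dist_nonneg[of p p]
  show ?thesis by (simp add: chart_inv_chart)
qed

lemma fs_dist_triangle: "fs_dist p q \<le> fs_dist p o' + fs_dist o' q"
proof -
  have "fs_dist p q - fs_dist o' q \<le> fs_dist p o'"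
  proof (rule fs_dist_ge)
    fix c1 assume c1: "piecewise_smooth_path c1" "c1 0 = p" "c1 1 = o'"
    \<comment> \<open>The two infima are handled in turn: over \<open>c2\<close> for a fixed
      \<open>c1\<close>, then over \<open>c1\<close>.\<close>
    have "fs_dist p q - fs_length c1 \<le> fs_dist o' q"
    proof (rule fs_dist_ge)
      fix c2 assume c2: "piecewise_smooth_path c2" "c2 0 = o'" "c2 1 = q"
      have j: "c1 1 = c2 0" using c1 c2 by simp
      have "fs_dist p q \<le> fs_length (c1 +++ c2)"
        by (rule fs_dist_le[OF piecewise_smooth_path_join[OF c1(1) c2(1) j]])
          (use c1 c2 in \<open>auto simp: joinpaths_def\<close>)
      then show "fs_dist p q - fs_length c1 \<le> fs_length c2"
        using fs_length_join[OF c1(1) c2(1) j] by simp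
    qed
    then show "fs_dist p q - fs_dist o' q \<le> fs_length c1" by simp
  qed
  then show ?thesis by simp
qed

section \<open>Openness of balls and sequential compactness\<close>

lemma open_chart_fs_ball: "open {w. chart_inv i w \<in> fs_ball x r}"
  unfolding open_dist
proof
  fix w assume w: "w \<in> {w. chart_inv i w \<in> fs_ball x r}"
  define e where "e = r - fs_dist x (chart_inv i w)"
  have "e > 0" using w by (simp add: e_def fs_ball_def)
  moreover have "w' \<in> {w. chart_inv i w \<in> fs_ball x r}" if "dist w' w < e" for w'
    using that fs_dist_triangle[of x "chart_inv i w'" "chart_inv i w"] fs_dist_chart_inv_le[of i w w']
    by (simp add: fs_ball_def e_def dist_norm)
  ultimately show "\<exists>e>0. \<forall>y. dist y w < e \<longrightarrow> y \<in> {w. chart_inv i w \<in> fs_ball x r}" by blast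
qed

text \<open>Lift the points to the compact unit sphere and pass to a limit there; near the limit one
  chart bounds \<open>fs_dist\<close> by a Euclidean distance. Both orders of the arguments are
  provided, so later estimates need no symmetry of \<open>fs_dist\<close>.\<close>

lemma fs_sequentially_compact:
  fixes u :: "nat \<Rightarrow> 'k::finite cproj"
  obtains p \<sigma> where "strict_mono \<sigma>" "(\<lambda>m. fs_dist p (u (\<sigma> m))) \<longlonglongrightarrow> 0" "(\<lambda>m. fs_dist (u (\<sigma> m)) p) \<longlonglongrightarrow> 0"
proof -
  have "\<exists>z. norm z = 1 \<and> u m = proj z" for m
  proof -
    obtain z where z: "z \<noteq> 0" "u m = proj z" by (rule cproj_cases)
    let ?z = "z /\<^sub>R norm z"
    have "?z = of_real (inverse (norm z)) *s z" by (rule scaleR_vec_conv_of_real)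
    moreover have "of_real (inverse (norm z)) \<noteq> (0::complex)" using z(1) by simp
    moreover have "?z \<noteq> 0" using z(1) by simp
    ultimately have "proj ?z = proj z" using z(1) proj_eq_iff by blast
    with z show ?thesis by (intro exI[of _ ?z]) simp
  qed
  then obtain Z where Z: "\<And>m. norm (Z m) = 1" "\<And>m. u m = proj (Z m)" by metis
  have "compact (sphere (0 :: complex ^ 'k option) 1)" by simp
  moreover have "\<forall>m. Z m \<in> sphere 0 1" using Z by simp
  ultimately obtain z \<sigma> where z: "z \<in> sphere 0 1" "strict_mono \<sigma>" "(Z \<circ> \<sigma>) \<longlonglongrightarrow> z"
    unfolding compact_def by metis
  then have "z \<noteq> 0" by auto
  then obtain i where i: "z $ i \<noteq> 0" by (auto simp: vec_eq_iff)
  have Zn: "(\<lambda>m. Z (\<sigma> m) $ j) \<longlonglongrightarrow> z $ j" for j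
    using tendsto_vec_nth[OF z(3), of j] by simp
  have "Z m \<noteq> 0" for m using Z(1)[of m] by auto
  then have ch: "chart i (u m) = (\<chi> j. Z m $ coord_index i j / Z m $ i)" for m
    by (simp add: Z(2) chart_proj)
  define p where "p = proj z"
  have chp: "chart i p = (\<chi> j. z $ coord_index i j / z $ i)" by (simp add: p_def chart_proj \<open>z \<noteq> 0\<close>)
  have p: "chart_inv i (chart i p) = p"
    using i \<open>z \<noteq> 0\<close> by (intro chart_inv_chart) (simp add: p_def affine_open_proj)
  have "(\<lambda>m. chart i (u (\<sigma> m))) \<longlonglongrightarrow> chart i p"
    unfolding ch chp using i by (intro tendsto_vec_lambda tendsto_divide Zn)
  then have lim: "(\<lambda>m. norm (chart i (u (\<sigma> m)) - chart i p)) \<longlonglongrightarrow> 0"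
    by (simp only: tendsto_norm_zero_iff LIM_zero_iff)
  have "\<forall>\<^sub>F m in sequentially. chart_inv i (chart i (u (\<sigma> m))) = u (\<sigma> m)"
  proof -
    have "\<forall>\<^sub>F m in sequentially. Z (\<sigma> m) $ i \<noteq> 0"
      using Zn i by (rule tendsto_imp_eventually_ne)
    then show ?thesis
      by eventually_elim (simp add: chart_inv_chart Z(2) affine_open_proj \<open>\<And>m. Z m \<noteq> 0\<close>)
  qed
  moreover have "fs_dist p v \<le> norm (chart i v - chart i p) \<and> fs_dist v p \<le> norm (chart i v - chart i p)"
    if "chart_inv i (chart i v) = v" for v
    using fs_dist_chart_inv_le[of i "chart i p" "chart i v"] fs_dist_chart_inv_le[of i "chart i v" "chart i p"]
    by (simp add: p that norm_minus_commute)
  ultimately have "\<forall>\<^sub>F m in sequentially. norm (fs_dist p (u (\<sigma> m))) \<le> norm (chart i (u (\<sigma> m)) - chart i p)"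
      "\<forall>\<^sub>F m in sequentially. norm (fs_dist (u (\<sigma> m)) p) \<le> norm (chart i (u (\<sigma> m)) - chart i p)"
    by (auto simp: fs_dist_nonneg elim: eventually_mono)
  then have "(\<lambda>m. fs_dist p (u (\<sigma> m))) \<longlonglongrightarrow> 0" "(\<lambda>m. fs_dist (u (\<sigma> m)) p) \<longlonglongrightarrow> 0"
    using lim by (auto intro: Lim_null_comparison)
  with that z(2) show ?thesis by blast
qed

section \<open>The maximum norm\<close>

lemma max_norm_le_iff: "max_norm v \<le> r \<longleftrightarrow> (\<forall>i. norm (v $ i) \<le> r)"
  unfolding max_norm_def by (subst Max_le_iff) auto

lemma norm_nth_le_max_norm: "norm (v $ i) \<le> max_norm v"
  using max_norm_le_iff by blast

lemma max_norm_nonneg: "0 \<le> max_norm v"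
  using norm_nth_le_max_norm norm_ge_zero order_trans by blast

lemma max_norm_0 [simp]: "max_norm 0 = 0"
  by (rule antisym[OF _ max_norm_nonneg]) (simp add: max_norm_le_iff)

lemma max_norm_eq_0: "max_norm v = 0 \<Longrightarrow> v = 0"
  using norm_nth_le_max_norm[of v] by (simp add: vec_eq_iff)

lemma max_norm_minus [simp]: "max_norm (- v) = max_norm v"
  by (simp add: max_norm_def)

lemma max_norm_minus_commute: "max_norm (u - v) = max_norm (v - u)"
  unfolding max_norm_def by (simp add: norm_minus_commute)

lemma max_norm_scaleR: "max_norm (c *\<^sub>R v) = \<bar>c\<bar> * max_norm v"
proof (cases "c = 0")
  case False
  have le: "max_norm (c *\<^sub>R v) \<le> \<bar>c\<bar> * max_norm v" for c and v :: "complex ^ 'a"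
    by (auto simp: max_norm_le_iff intro!: mult_left_mono norm_nth_le_max_norm)
  \<comment> \<open>The reverse bound is the forward one for the inverse scalar.\<close>
  from le[of "inverse c" "c *\<^sub>R v"] False have "\<bar>c\<bar> * max_norm v \<le> max_norm (c *\<^sub>R v)"
    by (simp add: field_simps)
  with le show ?thesis by (rule antisym)
qed simp

lemma max_norm_le_norm: "max_norm v \<le> norm v"
  by (simp add: max_norm_le_iff Finite_Cartesian_Product.norm_nth_le)

lemma max_norm_triangle: "max_norm (u + v) \<le> max_norm u + max_norm v"
  unfolding max_norm_le_iff
  by (auto intro!: order_trans[OF norm_triangle_ineq] add_mono norm_nth_le_max_norm)

lemma max_norm_lipschitz: "\<bar>max_norm u - max_norm v\<bar> \<le> norm (u - v)"
  using max_norm_triangle[of v "u - v"] max_norm_triangle[of u "v - u"]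
    max_norm_le_norm[of "u - v"] max_norm_le_norm[of "v - u"] norm_minus_commute[of u v]
  by simp

lemma tendsto_max_norm:
  assumes "(f \<longlongrightarrow> v) F" shows "((\<lambda>x. max_norm (f x)) \<longlongrightarrow> max_norm v) F"
proof -
  have "((\<lambda>x. norm (f x - v)) \<longlongrightarrow> 0) F"
    using assms by (simp only: tendsto_norm_zero_iff LIM_zero_iff)
  then have "((\<lambda>x. max_norm (f x) - max_norm v) \<longlongrightarrow> 0) F"
    by (rule Lim_null_comparison[rotated]) (simp add: max_norm_lipschitz)
  then show ?thesis by (simp add: LIM_zero_iff)
qed

lemma convex_polydisc: "convex (polydisc r :: (complex ^ 'n) set)"
  unfolding convex_def polydisc_def
proof safe
  fix u v :: "complex ^ 'n" and a b :: real
  assume "max_norm u < r" "max_norm v < r" "0 \<le> a" "0 \<le> b" "a + b = 1"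
  then have "a * max_norm u + b * max_norm v < r" by (rule convex_bound_lt)
  then show "max_norm (a *\<^sub>R u + b *\<^sub>R v) < r"
    using max_norm_triangle[of "a *\<^sub>R u" "b *\<^sub>R v"] \<open>0 \<le> a\<close> \<open>0 \<le> b\<close> by (simp add: max_norm_scaleR)
qed

section \<open>Expanding charts\<close>

lemma has_vector_derivative_imp_tendsto_right:
  assumes "(f has_vector_derivative f') (at a)"
  shows "((\<lambda>s. (f s - f a) /\<^sub>R (s - a)) \<longlongrightarrow> f') (at_right a)"
proof -
  have "(f has_derivative (\<lambda>h. h *\<^sub>R f')) (at_right a)"
    using assms unfolding has_vector_derivative_def by (rule has_derivative_at_withinI)
  then have lim: "((\<lambda>s. (1 / norm (s - a)) *\<^sub>R (f s - (f a + (s - a) *\<^sub>R f'))) \<longlongrightarrow> 0) (at_right a)"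
    by (simp add: has_derivative_within)
  have "\<forall>\<^sub>F s in at_right a. (1 / norm (s - a)) *\<^sub>R (f s - (f a + (s - a) *\<^sub>R f')) = (f s - f a) /\<^sub>R (s - a) - f'"
  proof (rule eventually_at_right_less[THEN eventually_mono])
    fix s assume "a < s"
    have "(1 / (s - a)) *\<^sub>R (X - (Y + (s - a) *\<^sub>R f')) = (X - Y) /\<^sub>R (s - a) - f'" for X Y
      using \<open>a < s\<close> by (simp add: scaleR_diff_right scaleR_add_right divide_inverse)
    then show "(1 / norm (s - a)) *\<^sub>R (f s - (f a + (s - a) *\<^sub>R f')) = (f s - f a) /\<^sub>R (s - a) - f'"
      using \<open>a < s\<close> by simp
  qed
  with lim have "((\<lambda>s. (f s - f a) /\<^sub>R (s - a) - f') \<longlongrightarrow> 0) (at_right a)"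
    by (rule Lim_transform_eventually)
  then show ?thesis by (simp add: LIM_zero_iff)
qed

text \<open>Both derivatives exist, so limits of right difference quotients suffice, and
  \<open>max_norm\<close> is continuous and homogeneous. A Lipschitz bound between curves becomes a
  bound between velocities.\<close>

lemma norm_vector_derivative_le_max_norm:
  fixes f :: "real \<Rightarrow> 'a::real_normed_vector" and g :: "real \<Rightarrow> complex ^ 'n"
  assumes f: "(f has_vector_derivative f') (at a)" and g: "(g has_vector_derivative g') (at a)"
    and le: "\<forall>\<^sub>F s in at_right a. norm (f s - f a) \<le> C * max_norm (g s - g a)"
  shows "norm f' \<le> C * max_norm g'"
proof (rule tendsto_le[OF trivial_limit_at_right_real])
  show "((\<lambda>s. C * max_norm ((g s - g a) /\<^sub>R (s - a))) \<longlongrightarrow> C * max_norm g') (at_right a)"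
    by (intro tendsto_mult tendsto_const tendsto_max_norm has_vector_derivative_imp_tendsto_right g)
  show "((\<lambda>s. norm ((f s - f a) /\<^sub>R (s - a))) \<longlongrightarrow> norm f') (at_right a)"
    by (intro tendsto_norm has_vector_derivative_imp_tendsto_right f)
  show "\<forall>\<^sub>F s in at_right a. norm ((f s - f a) /\<^sub>R (s - a)) \<le> C * max_norm ((g s - g a) /\<^sub>R (s - a))"
    using le eventually_at_right_less
  proof eventually_elim
    case (elim s)
    then have "norm (f s - f a) / (s - a) \<le> C * max_norm (g s - g a) / (s - a)"
      by (intro divide_right_mono) auto
    with elim show ?case by (simp add: max_norm_scaleR divide_inverse mult_ac)
  qed
qed

lemma fs_ball_mono: "r \<le> r' \<Longrightarrow> fs_ball x r \<subseteq> fs_ball x r'"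
  by (auto simp: fs_ball_def)

text \<open>Abstracts the maps \<open>\<phi> n\<close> on their balls. Only the lower Lipschitz
  bound is built in; an upper one is a separate hypothesis of \<open>polydisc_subset_image\<close>.
  Openness is phrased in chart coordinates, the form that \<open>open_chart_fs_ball\<close>
  supplies.\<close>

locale expanding_chart =
  fixes B :: "'k::finite cproj set" and \<phi> :: "'k cproj \<Rightarrow> complex ^ 'k" and K :: real
  assumes open_B: "open {w. chart_inv i w \<in> B}"
    and inj: "inj_on \<phi> B"
    and hol: "holomorphic_to_vec \<phi> B"
    and K_pos: "0 < K"
    and expanding: "\<lbrakk>u \<in> B; v \<in> B\<rbrakk> \<Longrightarrow> K * fs_dist u v \<le> max_norm (\<phi> u - \<phi> v)"
begin

lemma derivative:
  assumes "chart_inv i w \<in> B"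
  obtains D where "((\<phi> \<circ> chart_inv i) has_derivative D) (at w)" "\<And>c v. D (c *s v) = c *s D v"
  using assms hol unfolding holomorphic_to_vec_def holomorphic_vec_on_def by blast

lemma continuous_on_chart: "continuous_on {w. chart_inv i w \<in> B} (\<phi> \<circ> chart_inv i)"
  by (intro continuous_at_imp_continuous_on ballI)
    (metis mem_Collect_eq derivative has_derivative_continuous)

text \<open>Invariance of domain in each chart: the dimensions agree, and continuity and injectivity
  suffice.\<close>

lemma open_image:
  assumes "A \<subseteq> B" "\<And>i. open {w. chart_inv i w \<in> A}"
  shows "open (\<phi> ` A)"
proof -
  have "\<phi> ` A = (\<Union>i. (\<phi> \<circ> chart_inv i) ` {w. chart_inv i w \<in> A})"
  proof (intro equalityI subsetI)
    fix y assume "y \<in> \<phi> ` A"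
    then obtain u where u: "u \<in> A" "y = \<phi> u" by blast
    obtain i where "u \<in> affine_open i" using affine_open_cover by blast
    with u have "chart_inv i (chart i u) \<in> A" "y = (\<phi> \<circ> chart_inv i) (chart i u)"
      by (simp_all add: chart_inv_chart)
    then show "y \<in> (\<Union>i. (\<phi> \<circ> chart_inv i) ` {w. chart_inv i w \<in> A})" by blast
  qed auto
  moreover have "open ((\<phi> \<circ> chart_inv i) ` {w. chart_inv i w \<in> A})" for i
  proof (rule invariance_of_domain)
    show "continuous_on {w. chart_inv i w \<in> A} (\<phi> \<circ> chart_inv i)"
      using continuous_on_chart by (rule continuous_on_subset) (use assms(1) in auto)
    show "inj_on (\<phi> \<circ> chart_inv i) {w. chart_inv i w \<in> A}"
      by (intro comp_inj_on inj_on_subset[OF inj_chart_inv] inj_on_subset[OF inj]) (use assms(1) in auto)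
  qed (rule assms)
  ultimately show ?thesis by auto
qed

lemma segre_le_max_norm:
  assumes "u \<in> B" "v \<in> B"
  shows "norm (segre u - segre v) \<le> sqrt 2 / K * max_norm (\<phi> u - \<phi> v)"
proof -
  have "fs_dist v u \<le> max_norm (\<phi> u - \<phi> v) / K"
    using expanding[OF assms(2,1)] K_pos by (simp add: pos_le_divide_eq mult.commute max_norm_minus_commute)
  then have "sqrt 2 * fs_dist v u \<le> sqrt 2 * (max_norm (\<phi> u - \<phi> v) / K)" by (rule mult_left_mono) simp
  with segre_le_fs_dist[of u v] show ?thesis by simp
qed

text \<open>The expansion survives in the limit: along the line through \<open>w\<close> in
  direction \<open>v\<close> it bounds \<open>fs_norm w v\<close> by
  \<open>max_norm (D v) / K\<close>, and the Fubini-Study norm is definite.\<close>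

lemma derivative_nonsingular:
  assumes w: "chart_inv i w \<in> B" and D: "((\<phi> \<circ> chart_inv i) has_derivative D) (at w)" and "D v = 0"
  shows "v = 0"
proof -
  let ?l = "\<lambda>s::real. w + s *\<^sub>R v"
  have l: "(?l has_vector_derivative v) (at 0)"
    by (auto intro!: derivative_eq_intros)
  have "chart i \<circ> (\<lambda>s. chart_inv i (?l s)) = ?l" by (simp add: comp_def chart_chart_inv)
  then have "((segre \<circ> (\<lambda>s. chart_inv i (?l s))) has_vector_derivative
      line_projection_deriv (homog i 1 w) (homog i 0 v)) (at 0)"
    using has_vector_derivative_segre[of i "\<lambda>s. chart_inv i (?l s)" v 0 UNIV] l
    by (simp add: chart_inv_in_affine chart_chart_inv)
  moreover have "(((\<phi> \<circ> chart_inv i) \<circ> ?l) has_vector_derivative D v) (at 0)"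
    by (rule vector_derivative_diff_chain_within[OF l])
      (simp only: scaleR_zero_left add_0_right has_derivative_at_withinI[OF D])
  moreover have "\<forall>\<^sub>F s in at_right 0. norm ((segre \<circ> (\<lambda>s. chart_inv i (?l s))) s - (segre \<circ> (\<lambda>s. chart_inv i (?l s))) 0)
      \<le> sqrt 2 / K * max_norm (((\<phi> \<circ> chart_inv i) \<circ> ?l) s - ((\<phi> \<circ> chart_inv i) \<circ> ?l) 0)"
  proof -
    have "(?l \<longlongrightarrow> w + 0 *\<^sub>R v) (at_right 0)" by (intro tendsto_intros)
    from topological_tendstoD[OF this open_B[of i]]
    have "\<forall>\<^sub>F s in at_right 0. chart_inv i (?l s) \<in> B" using w by simp
    then show ?thesis
    proof eventually_elim
      case (elim s)
      from segre_le_max_norm[OF elim w] show ?case by simp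
    qed
  qed
  ultimately have "norm (line_projection_deriv (homog i 1 w) (homog i 0 v)) \<le> sqrt 2 / K * max_norm (D v)"
    by (rule norm_vector_derivative_le_max_norm)
  then have "fs_norm w v \<le> 0" using \<open>D v = 0\<close> by (simp add: norm_line_projection_deriv_homog mult_le_0_iff)
  then show ?thesis using fs_norm_pos[of v w] by fastforce
qed

definition \<psi> :: "complex ^ 'k \<Rightarrow> 'k cproj" where "\<psi> = inv_into B \<phi>"

lemma \<psi>_in [simp]: "y \<in> \<phi> ` B \<Longrightarrow> \<psi> y \<in> B"
  and \<phi>_\<psi> [simp]: "y \<in> \<phi> ` B \<Longrightarrow> \<phi> (\<psi> y) = y"
  and \<psi>_\<phi> [simp]: "u \<in> B \<Longrightarrow> \<psi> (\<phi> u) = u"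
  by (simp_all add: \<psi>_def inv_into_into f_inv_into_f inv_into_f_f[OF inj])

text \<open>Invariance of domain makes the inverse continuous, and the derivative of
  \<open>\<phi>\<close> is invertible, so the inverse is differentiable; the inverse of a complex
  linear map is again complex linear.\<close>

lemma inverse_derivative:
  assumes y: "y \<in> \<phi> ` B" "\<psi> y \<in> affine_open j"
  obtains D' where "((chart j \<circ> \<psi>) has_derivative D') (at y)" "\<And>c v. D' (c *s v) = c *s D' v"
    "isCont \<psi> y"
proof -
  let ?W = "{w. chart_inv j w \<in> B}" and ?f = "\<phi> \<circ> chart_inv j" and ?g = "chart j \<circ> \<psi>"
  have W: "chart_inv j (?g y) \<in> B" using y by (simp add: chart_inv_chart)
  obtain D where D: "(?f has_derivative D) (at (?g y))" "\<And>c v. D (c *s v) = c *s D v"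
    using derivative[OF W] by blast
  have gf: "?g (?f w) = w" if "w \<in> ?W" for w using that by (simp add: chart_chart_inv)
  then have "inj_on ?f ?W" by (rule inj_on_inverseI)
  with continuous_on_chart open_B have T: "open (?f ` ?W)" by (rule invariance_of_domain)
  have yT: "y \<in> ?f ` ?W" using W y by (intro image_eqI[of _ _ "?g y"]) (simp_all add: chart_inv_chart)
  have fg: "?f (?g z) = z" "chart_inv j (?g z) = \<psi> z" if "z \<in> ?f ` ?W" for z
    using that by (auto simp: chart_chart_inv)
  have "continuous_on (?f ` ?W) ?g"
    by (rule continuous_on_inverse_open[OF open_B continuous_on_chart order_refl gf])
  then have cont: "isCont ?g y" using continuous_on_eq_continuous_at[OF T] yT by blast
  have lin: "linear D" using D(1) has_derivative_linear by blast
  have "inj D"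
    using derivative_nonsingular[OF W D(1)] linear_injective_0[OF lin] by blast
  from linear_injective_left_inverse[OF lin this] obtain D'
    where D': "linear D'" "D' \<circ> D = id" by blast
  \<comment> \<open>Source and target have the same dimension. Surjectivity lets every
    \<open>v\<close> be written as \<open>D u\<close> when the complex linearity of
    \<open>D'\<close> is checked.\<close>
  have surj: "surj D" by (rule linear_injective_imp_surjective[OF lin \<open>inj D\<close> refl])
  have "(?g has_derivative D') (at y)"
    by (rule has_derivative_inverse_basic[OF D(1) _ D'(2) cont T yT fg(1)])
      (use D'(1) in \<open>simp_all add: linear_conv_bounded_linear\<close>)
  moreover have "D' (c *s v) = c *s D' v" for c v
  proof -
    obtain u where u: "v = D u" using surj by blast
    have "D' (D z) = z" for z using D'(2) by (metis comp_apply id_apply)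
    then show ?thesis by (simp add: u D(2)[symmetric])
  qed
  moreover have "isCont \<psi> y"
  proof -
    have "isCont (chart_inv j) (?g y)"
      using continuous_chart_inv[of j] by (simp add: continuous_on_eq_continuous_at)
    with cont have c: "isCont (\<lambda>z. chart_inv j (?g z)) y" by (rule isCont_o2)
    have "\<forall>\<^sub>F z in nhds y. chart_inv j (?g z) = \<psi> z"
      using eventually_nhds_in_open[OF T yT] by eventually_elim (rule fg(2))
    from isCont_cong[OF this] c show ?thesis by (rule iffD1)
  qed
  ultimately show ?thesis by (rule that)
qed

text \<open>While \<open>\<phi>\<close> moves with velocity \<open>Q - P\<close>, the lower
  Lipschitz bound limits the speed of the preimage to \<open>max_norm (Q - P) / K\<close>; integrate
  over the unit interval. Smoothness comes from the complex line through \<open>P\<close> and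
  \<open>Q\<close>, along which the inverse is holomorphic.\<close>

lemma lifted_segment:
  assumes seg: "\<And>t. t \<in> {0..1} \<Longrightarrow> P + t *\<^sub>R (Q - P) \<in> \<phi> ` B"
  defines "c \<equiv> \<lambda>t. \<psi> (P + t *\<^sub>R (Q - P))"
  shows "smooth_curve_on {0..1} c" "fs_length c \<le> max_norm (Q - P) / K"
proof -
  let ?l = "\<lambda>s::complex. P + s *s (Q - P)"
  let ?U = "?l -` (\<phi> ` B)"
  have eq: "?l (of_real t) = P + t *\<^sub>R (Q - P)" for t
    by (simp only: scaleR_vec_conv_of_real)
  have "smooth_curve_on {0..1} (\<lambda>t. (\<lambda>s. \<psi> (?l s)) (of_real t))"
  proof (rule smooth_curve_on_holomorphic)
    show "open ?U"
      by (rule open_vimage[OF open_image[OF order_refl open_B] continuous_on_complex_line])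
    show "continuous_on ?U (\<lambda>s. \<psi> (?l s))"
    proof (intro continuous_at_imp_continuous_on ballI)
      fix s assume "s \<in> ?U"
      then have s: "?l s \<in> \<phi> ` B" by simp
      obtain j where "\<psi> (?l s) \<in> affine_open j" using affine_open_cover by blast
      with s have "isCont \<psi> (?l s)" by (rule inverse_derivative)
      with has_derivative_continuous[OF has_derivative_complex_line] show "isCont (\<lambda>s. \<psi> (?l s)) s"
        by (rule isCont_o2)
    qed
    fix i j s assume "s \<in> ?U" and "\<psi> (?l s) \<in> affine_open i"
    then have s: "?l s \<in> \<phi> ` B" "\<psi> (?l s) \<in> affine_open i" by auto
    obtain D' where D': "((chart i \<circ> \<psi>) has_derivative D') (at (?l s))" "\<And>c v. D' (c *s v) = c *s D' v"
      using inverse_derivative[OF s] by metis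
    have "((\<lambda>s. (chart i \<circ> \<psi>) (?l s)) has_derivative (\<lambda>h. D' (h *s (Q - P)))) (at s)"
      using has_derivative_compose[OF has_derivative_complex_line D'(1)] .
    from bounded_linear.has_derivative[OF bounded_linear_vec_nth this, of j]
    moreover have "(\<lambda>h. D' (h *s (Q - P)) $ j) = (*) (D' (Q - P) $ j)"
      by (simp only: fun_eq_iff D'(2)) (simp add: mult.commute)
    ultimately have "((\<lambda>s. chart i (\<psi> (?l s)) $ j) has_field_derivative D' (Q - P) $ j) (at s)"
      unfolding has_field_derivative_def by (simp only: comp_apply)
    then show "(\<lambda>s. chart i (\<psi> (?l s)) $ j) field_differentiable at s"
      unfolding field_differentiable_def by blast
  next
    fix t :: real assume "t \<in> {0..1}"
    then show "of_real t \<in> ?U" using seg[of t] by (simp only: vimage_eq eq)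
  qed
  then show c: "smooth_curve_on {0..1} c" by (simp only: c_def eq)
  show "fs_length c \<le> max_norm (Q - P) / K"
  proof (rule fs_length_le[OF c])
    fix t :: real assume t: "t \<in> {0<..<1}"
    have cB: "c s \<in> B \<and> \<phi> (c s) = P + s *\<^sub>R (Q - P)" if "s \<in> {0..1}" for s
      using seg[OF that] by (simp add: c_def)
    have d: "(segre \<circ> c) differentiable at t" "sqrt 2 * fs_speed c t = norm (vector_derivative (segre \<circ> c) (at t))"
      using smooth_piece_segre[OF c _ _ _ t] by auto
    from d(1) have "((segre \<circ> c) has_vector_derivative vector_derivative (segre \<circ> c) (at t)) (at t)"
      by (simp add: vector_derivative_works)
    moreover have "((\<lambda>s. P + s *\<^sub>R (Q - P)) has_vector_derivative (Q - P)) (at t)"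
      by (auto intro!: derivative_eq_intros)
    moreover have "\<forall>\<^sub>F s in at_right t. norm ((segre \<circ> c) s - (segre \<circ> c) t)
        \<le> sqrt 2 / K * max_norm ((P + s *\<^sub>R (Q - P)) - (P + t *\<^sub>R (Q - P)))"
    proof -
      have "\<forall>\<^sub>F s in at_right t. s < 1" using t by (intro eventually_at_right_real[THEN eventually_mono]) auto
      then show ?thesis using eventually_at_right_less
      proof eventually_elim
        case (elim s)
        with t have "s \<in> {0..1}" "t \<in> {0..1}" by auto
        with segre_le_max_norm[of "c s" "c t"] cB show ?case by (simp only: comp_def)
      qed
    qed
    ultimately have "sqrt 2 * fs_speed c t \<le> sqrt 2 / K * max_norm (Q - P)"
      unfolding d(2) by (rule norm_vector_derivative_le_max_norm)
    then have "sqrt 2 * fs_speed c t \<le> sqrt 2 * (max_norm (Q - P) / K)" by simp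
    then show "fs_speed c t \<le> max_norm (Q - P) / K" by (subst (asm) mult_le_cancel_left_pos) auto
  qed
qed

text \<open>The image is open in the polydisc by invariance of domain, and closed in it because
  \<open>\<phi>\<close> is expanding and \<open>\<P>\<^sup>k\<close> is compact.\<close>

lemma polydisc_subset_image:
  assumes B: "B = fs_ball x R" and \<phi>x: "\<phi> x = 0"
    and lip: "\<And>u v. u \<in> B \<Longrightarrow> v \<in> B \<Longrightarrow> max_norm (\<phi> u - \<phi> v) \<le> h * fs_dist u v"
    and s: "0 < s" "s \<le> R"
  shows "polydisc (K * s) \<subseteq> \<phi> ` fs_ball x s"
proof -
  let ?S = "polydisc (K * s) :: (complex ^ 'k) set" and ?A = "fs_ball x s"
  have AB: "?A \<subseteq> B" using s by (auto simp: B fs_ball_def)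
  have xA: "x \<in> ?A" using s by (simp add: fs_ball_def)
  then have xB: "x \<in> B" using AB by blast
  have oA: "open (\<phi> ` ?A)" by (rule open_image[OF AB open_chart_fs_ball])
  have "openin (top_of_set ?S) (?S \<inter> \<phi> ` ?A)" using oA by (rule openin_open_Int)
  moreover have "closedin (top_of_set ?S) (?S \<inter> \<phi> ` ?A)"
    unfolding closedin_limpt
  proof (intro conjI allI impI)
    fix y assume "y islimpt (?S \<inter> \<phi> ` ?A) \<and> y \<in> ?S"
    then obtain Y where Y: "\<And>m. Y m \<in> \<phi> ` ?A" "Y \<longlonglongrightarrow> y" and yS: "max_norm y < K * s"
      unfolding islimpt_sequential polydisc_def by blast
    from Y(1) have "\<forall>m. \<exists>u. u \<in> ?A \<and> Y m = \<phi> u" by blast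
    then obtain u where u: "\<And>m. u m \<in> ?A" "\<And>m. Y m = \<phi> (u m)" by metis
    obtain p \<sigma> where \<sigma>: "strict_mono \<sigma>" and p: "(\<lambda>m. fs_dist p (u (\<sigma> m))) \<longlonglongrightarrow> 0"
        "(\<lambda>m. fs_dist (u (\<sigma> m)) p) \<longlonglongrightarrow> 0"
      by (rule fs_sequentially_compact)
    have Y\<sigma>: "(\<lambda>m. \<phi> (u (\<sigma> m))) \<longlonglongrightarrow> y"
      using LIMSEQ_subseq_LIMSEQ[OF Y(2) \<sigma>] by (simp add: comp_def u(2))
    \<comment> \<open>The lower Lipschitz bound passes to the limit; the strict bound on
      \<open>max_norm y\<close> then puts \<open>p\<close> in the open ball of radius
      \<open>s\<close>.\<close>
    have "fs_dist x p \<le> max_norm y / K"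
    proof (rule tendsto_lowerbound)
      show "(\<lambda>m. max_norm (\<phi> (u (\<sigma> m))) / K + fs_dist (u (\<sigma> m)) p) \<longlonglongrightarrow> max_norm y / K"
        using tendsto_add[OF tendsto_divide[OF tendsto_max_norm[OF Y\<sigma>] tendsto_const] p(2)] K_pos by simp
      have "fs_dist x p \<le> max_norm (\<phi> (u m)) / K + fs_dist (u m) p" for m
      proof -
        have "K * fs_dist x (u m) \<le> max_norm (\<phi> (u m))"
          using expanding[OF xB, of "u m"] u(1)[of m] AB by (auto simp: \<phi>x)
        then have "fs_dist x (u m) \<le> max_norm (\<phi> (u m)) / K"
          using K_pos by (simp add: pos_le_divide_eq mult.commute)
        with fs_dist_triangle[of x p "u m"] show ?thesis by simp
      qed
      then show "\<forall>\<^sub>F m in sequentially. fs_dist x p \<le> max_norm (\<phi> (u (\<sigma> m))) / K + fs_dist (u (\<sigma> m)) p"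
        by simp
    qed simp
    also have "\<dots> < s" using yS K_pos by (simp add: pos_divide_less_eq mult.commute)
    finally have pA: "p \<in> ?A" by (simp add: fs_ball_def)
    \<comment> \<open>The upper Lipschitz bound shows that \<open>\<phi> (u (\<sigma> m))\<close>
      converges to \<open>\<phi> p\<close>, so \<open>y = \<phi> p\<close>.\<close>
    have "max_norm (\<phi> p - y) \<le> h * 0"
    proof (rule tendsto_le[OF sequentially_bot])
      show "(\<lambda>m. h * fs_dist p (u (\<sigma> m))) \<longlonglongrightarrow> h * 0" by (intro tendsto_mult tendsto_const p)
      show "(\<lambda>m. max_norm (\<phi> p - \<phi> (u (\<sigma> m)))) \<longlonglongrightarrow> max_norm (\<phi> p - y)"
        by (intro tendsto_max_norm tendsto_diff tendsto_const Y\<sigma>)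
      show "\<forall>\<^sub>F m in sequentially. max_norm (\<phi> p - \<phi> (u (\<sigma> m))) \<le> h * fs_dist p (u (\<sigma> m))"
        by (intro always_eventually allI lip) (use pA u(1) AB in auto)
    qed
    then have "\<phi> p - y = 0" using max_norm_nonneg[of "\<phi> p - y"] by (intro max_norm_eq_0) simp
    then show "y \<in> ?S \<inter> \<phi> ` ?A" using pA yS by (auto simp: polydisc_def)
  qed auto
  moreover have "0 \<in> ?S \<inter> \<phi> ` ?A"
    using xA \<phi>x s K_pos by (auto simp: polydisc_def intro: image_eqI[of _ _ x])
  moreover have "connected ?S" using convex_polydisc by (rule convex_connected)
  ultimately show ?thesis unfolding connected_clopen by blast
qed

end

section \<open>Transport of segments by the inverse branches\<close>

text \<open>The length bound is non-strict: for \<open>p = q\<close> its right-hand side is 0, while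
  no path has negative length.\<close>

theorem mainTheorem2:
  fixes f :: "'k::{finite,linorder} cproj \<Rightarrow> 'k cproj" and d :: nat
    and \<mu> :: "'k cproj measure"
    and l :: nat and \<Lambda> :: "nat \<Rightarrow> real" and ks :: "nat \<Rightarrow> nat"
    and a \<gamma> \<epsilon> :: real
    and x :: "int \<Rightarrow> 'k cproj"
    and n0 :: nat and h r \<rho> :: real
    and \<phi> :: "nat \<Rightarrow> 'k cproj \<Rightarrow> (complex, 'k) vec"
    and D :: "nat \<Rightarrow> (complex, 'k) vec \<Rightarrow> (complex, 'k) vec"
    and finv :: "nat \<Rightarrow> 'k cproj \<Rightarrow> 'k cproj"
    and E Etilde :: "nat \<Rightarrow> real \<Rightarrow> 'k cproj set"
  assumes "2 \<le> d" and "holomorphic_endomorphism f d"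
    and "equilibrium_measure f d \<mu>"
    and "lyapunov_spectrum f \<mu> l \<Lambda> ks"
    and "resonance_gap TYPE('k) l \<Lambda> ks a"
    and "constraints l \<Lambda> a \<gamma> \<epsilon>"
    and "x \<in> noncritical_orbits f"
    and "linearization_data f l \<Lambda> ks \<gamma> \<epsilon> x n0 h r \<rho> \<phi> D finv"
    and "\<And>n t. E n t = finv n ` fs_ball (x 0) (t * (r / h))"
    and "\<And>n t. Etilde n t = finv n ` fs_ball (x 0) (t * r)"
  shows "\<forall>n\<ge>n0. \<forall>t. 0 < t \<and> t \<le> 1 \<longrightarrow>
           E n t \<subseteq> Etilde n t \<and>
           (\<forall>p\<in>E n t. \<forall>q\<in>E n t.
              \<exists>c. smooth_curve_on {0..1} c \<and> c 0 = p \<and> c 1 = q \<and> c ` {0..1} \<subseteq> Etilde n t \<and>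
                  fs_length c \<le> exp (5 * real n * \<epsilon>) * h * fs_dist p q)"
proof -
  note lin = assms(8)[unfolded linearization_data_def Let_def]
  \<comment> \<open>Six scalar bounds on \<open>n0\<close>, \<open>h\<close>, \<open>r\<close> and
    \<open>\<rho>\<close> precede the conditions on the charts, on \<open>D\<close> and on the
    branches.\<close>
  note data = lin[THEN conjunct2, THEN conjunct2, THEN conjunct2, THEN conjunct2, THEN conjunct2, THEN conjunct2]
  note E = assms(9) and Et = assms(10)
  define B where "B n = fs_ball (x (- int n)) (r * exp (- real n * (\<gamma> + 2 * \<epsilon>)))" for n
  define K where "K n = exp (real n * (\<gamma> - 2 * \<epsilon>))" for n
  have h: "1 \<le> h" using lin by (elim conjE)
  have r: "0 < r" using lin by (elim conjE)
  have charts: "inj_on (\<phi> n) (B n) \<and> holomorphic_to_vec (\<phi> n) (B n) \<and> \<phi> n (x (- int n)) = 0 \<and>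
      (\<forall>u\<in>B n. \<forall>v\<in>B n. K n * fs_dist u v \<le> max_norm (\<phi> n u - \<phi> n v) \<and>
         max_norm (\<phi> n u - \<phi> n v) \<le> exp (real n * (\<gamma> + 3 * \<epsilon>)) * h * fs_dist u v)" for n
    unfolding B_def K_def using data[THEN conjunct1, THEN spec, of n] by (elim conjE, intro conjI)
  have upper: "max_norm (\<phi> n u - \<phi> n v) \<le> exp (real n * (\<gamma> + 3 * \<epsilon>)) * h * fs_dist u v"
    if "u \<in> B n" "v \<in> B n" for n u v
    using charts that by blast
  have Dlin: "Vector_Spaces.linear (*s) (*s) (D n)" for n
    using data[THEN conjunct2, THEN conjunct1, THEN spec, of n] by (rule conjunct1)
  have branch: "finv n y \<in> B n" "\<phi> n (finv n y) = D n (\<phi> 0 y)" if "n0 \<le> n" "y \<in> fs_ball (x 0) r" for n y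
    using data[THEN conjunct2, THEN conjunct2, THEN spec, of n] that unfolding B_def by blast+
  interpret ch: expanding_chart "B n" "\<phi> n" "K n" for n
    by unfold_locales (use charts[of n] open_chart_fs_ball in \<open>auto simp: B_def K_def\<close>)
  \<comment> \<open>At \<open>n = 0\<close> all exponentials are 1: on the ball of radius
    \<open>r\<close>, \<open>\<phi> 0\<close> is expanding with constant 1 and Lipschitz with
    constant \<open>h\<close>.\<close>
  have B0: "B 0 = fs_ball (x 0) r" and K0: "K 0 = 1" by (simp_all add: B_def K_def)
  have \<phi>0: "\<phi> 0 (x 0) = 0" using charts[of 0] by simp
  have up0: "max_norm (\<phi> 0 u - \<phi> 0 v) \<le> h * fs_dist u v" if "u \<in> B 0" "v \<in> B 0" for u v
    using upper[OF that] by simp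
  show ?thesis
  proof (intro allI impI)
    fix n t assume n: "n0 \<le> n" and t: "0 < t \<and> t \<le> (1::real)"
    have rh: "r / h \<le> r" "0 < r / h" using h r by (simp_all add: divide_le_eq mult_left_le)
    have tr: "t * (r / h) \<le> t * r" "t * r \<le> r" using t r rh(1) by (simp_all only: mult_left_mono mult_left_le_one_le less_imp_le)
    note balls = fs_ball_mono[OF tr(2), of "x 0"] fs_ball_mono[OF order_trans[OF tr], of "x 0"]
    have sub: "E n t \<subseteq> Etilde n t" unfolding E Et by (intro image_mono fs_ball_mono tr(1))
    \<comment> \<open>The quotient \<open>r / h\<close> offsets the Lipschitz constant
      \<open>h\<close> of \<open>\<phi> 0\<close>, so the small ball lands in the polydisc of radius
      \<open>t * r\<close>.\<close>
    have disc: "\<phi> 0 y \<in> polydisc (t * r)" if y: "y \<in> fs_ball (x 0) (t * (r / h))" for y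
    proof -
      have "max_norm (\<phi> 0 y) = max_norm (\<phi> 0 (x 0) - \<phi> 0 y)" by (simp add: \<phi>0)
      also have "\<dots> \<le> h * fs_dist (x 0) y"
        using y balls r by (intro up0) (auto simp: B0 fs_ball_def[of _ r])
      also have "\<dots> < h * (t * (r / h))" using y h by (intro mult_strict_left_mono) (auto simp: fs_ball_def)
      finally show ?thesis using h by (simp add: polydisc_def)
    qed
    \<comment> \<open>Since \<open>K 0 = 1\<close>, the polydisc and the ball covering it have the
      same radius.\<close>
    have onto: "polydisc (t * r) \<subseteq> \<phi> 0 ` fs_ball (x 0) (t * r)"
      using ch.polydisc_subset_image[where n=0, OF B0 \<phi>0 up0, of "t * r"] t r tr by (simp add: K0)
    have "\<exists>c. smooth_curve_on {0..1} c \<and> c 0 = p \<and> c 1 = q \<and> c ` {0..1} \<subseteq> Etilde n t \<and>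
                  fs_length c \<le> exp (5 * real n * \<epsilon>) * h * fs_dist p q"
      if p: "p \<in> E n t" and q: "q \<in> E n t" for p q
    proof -
      obtain y z where y: "y \<in> fs_ball (x 0) (t * (r / h))" "p = finv n y"
        and z: "z \<in> fs_ball (x 0) (t * (r / h))" "q = finv n z"
        using p q unfolding E by blast
      have yz: "y \<in> fs_ball (x 0) r" "z \<in> fs_ball (x 0) r" using y z balls by auto
      have pB: "p \<in> B n" and qB: "q \<in> B n" using branch(1)[OF n] yz y z by auto
      \<comment> \<open>By convexity of the polydisc the segment between \<open>\<phi> 0 y\<close>
        and \<open>\<phi> 0 z\<close> lifts to points \<open>v\<close> of the larger ball; linearity
        of \<open>D n\<close> and the conjugacy carry it to the segment between
        \<open>\<phi> n p\<close> and \<open>\<phi> n q\<close>.\<close>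
      have seg: "\<exists>v\<in>fs_ball (x 0) (t * r). finv n v \<in> B n \<and> \<phi> n (finv n v) = \<phi> n p + s *\<^sub>R (\<phi> n q - \<phi> n p)"
        if s: "s \<in> {0..1}" for s
      proof -
        have "(1 - s) *\<^sub>R \<phi> 0 y + s *\<^sub>R \<phi> 0 z \<in> polydisc (t * r)"
          using s by (intro convexD[OF convex_polydisc] disc y z) auto
        from subsetD[OF onto this] obtain v
          where v: "(1 - s) *\<^sub>R \<phi> 0 y + s *\<^sub>R \<phi> 0 z = \<phi> 0 v" "v \<in> fs_ball (x 0) (t * r)"
          by (rule imageE)
        have vr: "v \<in> fs_ball (x 0) r" using v balls by auto
        have "\<phi> n (finv n v) = D n (\<phi> 0 v)" by (rule branch(2)[OF n vr])
        also have "\<dots> = (1 - s) *\<^sub>R D n (\<phi> 0 y) + s *\<^sub>R D n (\<phi> 0 z)"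
          \<comment> \<open>\<open>D n\<close> is linear for the complex scaling \<open>*s\<close>,
            so the real weights are first written as complex numbers.\<close>
          unfolding v(1)[symmetric] scaleR_vec_conv_of_real
          by (simp only: vec.linear_add[OF Dlin] vec.linear_scale[OF Dlin])
        also have "\<dots> = \<phi> n p + s *\<^sub>R (\<phi> n q - \<phi> n p)"
          by (simp add: y z branch(2)[OF n] yz algebra_simps)
        finally show ?thesis using v(2) branch(1)[OF n vr] by blast
      qed
      let ?c = "\<lambda>s. ch.\<psi> n (\<phi> n p + s *\<^sub>R (\<phi> n q - \<phi> n p))"
      have im: "\<phi> n p + s *\<^sub>R (\<phi> n q - \<phi> n p) \<in> \<phi> n ` B n" "?c s \<in> Etilde n t"
        if s: "s \<in> {0..1}" for s
      proof -
        obtain v where v: "v \<in> fs_ball (x 0) (t * r)" "finv n v \<in> B n"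
            "\<phi> n (finv n v) = \<phi> n p + s *\<^sub>R (\<phi> n q - \<phi> n p)"
          using seg[OF s] by blast
        from v(2,3) show "\<phi> n p + s *\<^sub>R (\<phi> n q - \<phi> n p) \<in> \<phi> n ` B n" by (metis image_eqI)
        \<comment> \<open>Since \<open>\<phi> n\<close> is injective on \<open>B n\<close>, the
          lifted point is \<open>finv n v\<close> itself.\<close>
        show "?c s \<in> Etilde n t" using v(1) unfolding v(3)[symmetric] Et by (simp add: v(2))
      qed
      have "smooth_curve_on {0..1} ?c" by (rule ch.lifted_segment(1)[OF im(1)])
      moreover have "?c 0 = p" "?c 1 = q" using pB qB by simp_all
      moreover have "?c ` {0..1} \<subseteq> Etilde n t" using im(2) by blast
      moreover have "fs_length ?c \<le> exp (5 * real n * \<epsilon>) * h * fs_dist p q"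
      proof -
        have "fs_length ?c \<le> max_norm (\<phi> n p - \<phi> n q) / K n"
          using ch.lifted_segment(2)[OF im(1)] by (simp add: max_norm_minus_commute)
        also have "\<dots> \<le> exp (real n * (\<gamma> + 3 * \<epsilon>)) * h * fs_dist p q / K n"
          by (rule divide_right_mono[OF upper[OF pB qB]]) (simp add: K_def)
        \<comment> \<open>The exponents of the two Lipschitz constants differ by 3\<epsilon> +
          2\<epsilon> per step, whence the factor 5.\<close>
        also have "\<dots> = exp (real n * (\<gamma> + 3 * \<epsilon>) - real n * (\<gamma> - 2 * \<epsilon>)) * h * fs_dist p q"
          by (simp add: K_def exp_diff)
        also have "real n * (\<gamma> + 3 * \<epsilon>) - real n * (\<gamma> - 2 * \<epsilon>) = 5 * real n * \<epsilon>"
          by (simp add: algebra_simps)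
        finally show ?thesis .
      qed
      ultimately show ?thesis by blast
    qed
    with sub show "E n t \<subseteq> Etilde n t \<and> (\<forall>p\<in>E n t. \<forall>q\<in>E n t.
              \<exists>c. smooth_curve_on {0..1} c \<and> c 0 = p \<and> c 1 = q \<and> c ` {0..1} \<subseteq> Etilde n t \<and>
                  fs_length c \<le> exp (5 * real n * \<epsilon>) * h * fs_dist p q)" by blast
  qed
qed

end
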